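(* Let $k>0$ be such that $k^2$ is not a Dirichlet eigenvalue of the Laplacian on the unit disc. Let $1<R<\rho$, and let $v$ be fixed analytic boundary data on the unit circle whose Fourier coefficients satisfy $|\hat v(m)|\sim C_0\,\rho^{-|m|}$ as $|m|\to\infty$ ($m\in\mathbb{Z}$), for some constant $C_0>0$. Then, as $N\to\infty$ through the even positive integers, there exists a sequence of coefficient vectors $\bm\alpha=\bm\alpha^{(N)}\in\mathbb{C}^N$ whose Euclidean norms $|\bm\alpha^{(N)}|$ are bounded independently of $N$, and whose boundary errors satisfy $$ t[\bm\alpha^{(N)}] \;\le\; \begin{cases} C\rho^{-N/2}, & \rho<R^2,\\ C\sqrt{N}\,R^{-N}, & \rho=R^2,\\ C R^{-N}, & \rho>R^2, \end{cases} $$ where $C$ is a constant which may depend on $k$, $R$ and $v$, but not on $N$.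
   Context: Identify $\mathbb{R}^2$ with $\mathbb{C}$. $\Omega=\{x:|x|<1\}$ is the unit disc, with boundary $\partial\Omega$ the unit circle. For a function $v$ on $\partial\Omega$, its Fourier coefficients are $\hat v(m)=\frac{1}{2\pi}\int_0^{2\pi} v(e^{i\theta})e^{-im\theta}\,d\theta$, $m\in\mathbb{Z}$. "$a_m\sim b_m$ as $|m|\to\infty$" means $a_m/b_m\to1$. For a positive even integer $N$, the charge points are $y_j=Re^{i\phi_j}$ with $\phi_j=2\pi j/N$, $j=1,\dots,N$. For a coefficient vector $\bm\alpha=(\alpha_1,\dots,\alpha_N)\in\mathbb{C}^N$, the Method of Fundamental Solutions (MFS) representation is $$u^{(N)}(x)=\frac{i}{4}\sum_{j=1}^N\alpha_j H_0^{(1)}(k|x-y_j|),$$ where $H_0^{(1)}$ is the Hankel function of the first kind of order zero. The boundary error is $t[\bm\alpha]=\|u^{(N)}-v\|_{L^2(\partial\Omega)}$, and $|\bm\alpha|=(|\alpha_1|^2+\dots+|\alpha_N|^2)^{1/2}$ is the Euclidean norm. The condition that $k^2$ is not a Dirichlet eigenvalue of the unit disc means $J_m(k)\ne0$ for all $m\in\mathbb{Z}$, where $J_m$ is the Bessel function of the first kind. *)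

theory Defs
  imports "HOL-Complex_Analysis.Complex_Analysis" "HOL-Library.Landau_Symbols"
begin

text \<open>
  Bessel function of the first kind of integer order, by its power series.
  Since \<open>rGamma\<close> vanishes at the non-positive integers, the terms with
  \<open>j + m < 0\<close> drop out, so negative orders need no separate treatment.
\<close>

definition bessel_J :: "int \<Rightarrow> real \<Rightarrow> real" where
  "bessel_J m x =
     (\<Sum>j. (-1) ^ j / fact j * rGamma (of_int (m + int j + 1)) * (x / 2) powi (2 * int j + m))"

text \<open>
  Bessel function of the second kind of order zero, for \<open>x > 0\<close>, by its standard
  logarithmic expansion; \<open>harm j\<close> is the harmonic number \<open>1 + 1/2 + \<dots> + 1/j\<close>.
\<close>

definition bessel_Y0 :: "real \<Rightarrow> real" where
  "bessel_Y0 x =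
     2 / pi * (ln (x / 2) + euler_mascheroni) * bessel_J 0 x
     + 2 / pi * (\<Sum>j. (-1) ^ (j + 1) * harm j / (fact j)\<^sup>2 * (x\<^sup>2 / 4) ^ j)"

definition hankel1_0 :: "real \<Rightarrow> complex" where
  "hankel1_0 x = Complex (bessel_J 0 x) (bessel_Y0 x)"

text \<open>Functions on the unit circle are total functions on the complex plane of which
  only the values on the circle matter.\<close>

definition fourier_coeff :: "(complex \<Rightarrow> complex) \<Rightarrow> int \<Rightarrow> complex" where
  "fourier_coeff v m =
     1 / (2 * pi) * integral {0..2*pi} (\<lambda>\<theta>. v (cis \<theta>) * cis (- (of_int m * \<theta>)))"

definition circle_L2_norm :: "(complex \<Rightarrow> complex) \<Rightarrow> real" where
  "circle_L2_norm w = sqrt (integral {0..2*pi} (\<lambda>\<theta>. (cmod (w (cis \<theta>)))\<^sup>2))"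

text \<open>
  Analyticity of a function given on the unit circle only: near every point of the circle
  it is the restriction of a holomorphic function. The extension is existentially
  quantified, so nothing is required of \<open>v\<close> off the circle.
\<close>

definition analytic_on_circle :: "(complex \<Rightarrow> complex) \<Rightarrow> bool" where
  "analytic_on_circle v \<longleftrightarrow> (\<exists>f. f analytic_on sphere 0 1 \<and> (\<forall>z\<in>sphere 0 1. v z = f z))"

definition charge_point :: "real \<Rightarrow> nat \<Rightarrow> nat \<Rightarrow> complex" where
  "charge_point R N j = of_real R * cis (2 * pi * real j / real N)"

text \<open>Only the entries \<open>\<alpha> 1, \<dots>, \<alpha> N\<close> of a coefficient vector are used.\<close>

definition mfs :: "real \<Rightarrow> real \<Rightarrow> nat \<Rightarrow> (nat \<Rightarrow> complex) \<Rightarrow> complex \<Rightarrow> complex" where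
  "mfs k R N \<alpha> x =
     \<i> / 4 * (\<Sum>j=1..N. \<alpha> j * hankel1_0 (k * cmod (x - charge_point R N j)))"

definition boundary_error ::
    "real \<Rightarrow> real \<Rightarrow> (complex \<Rightarrow> complex) \<Rightarrow> nat \<Rightarrow> (nat \<Rightarrow> complex) \<Rightarrow> real" where
  "boundary_error k R v N \<alpha> = circle_L2_norm (\<lambda>x. mfs k R N \<alpha> x - v x)"

definition coeff_norm :: "nat \<Rightarrow> (nat \<Rightarrow> complex) \<Rightarrow> real" where
  "coeff_norm N \<alpha> = L2_set (\<lambda>j. cmod (\<alpha> j)) {1..N}"

end

theory Submission
  imports Defs
begin

text \<open>
  The charges sit at the vertices of a regular \<open>N\<close>-gon, so in Fourier space the map from
  coefficient vectors to boundary values is nearly diagonal. Let \<open>g l\<close> be the Fourier coefficients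
  of the kernel \<open>H_0(k \<bar>e\<^sup>i\<^sup>\<theta> - R\<bar>)\<close>, so that on the circle it equals \<open>\<Sum>l. g l * e\<^sup>i\<^sup>l\<^sup>\<theta>\<close>. If
  \<open>\<alpha>\<close> is the inverse discrete Fourier transform of a sequence \<open>\<beta>\<close> on the window
  \<open>-N/2 \<le> m < N/2\<close>, then the \<open>l\<close>-th Fourier coefficient of the MFS field is
  \<open>i/4 * g l * \<beta> m\<close>, where \<open>m\<close> is the representative of \<open>l\<close> modulo \<open>N\<close> in the window
  (\<open>mfs_has_sum\<close>). The choice \<open>\<beta> m = v_m / (i/4 * g m)\<close>, with \<open>v_m\<close> the Fourier coefficients of
  the data, matches these exactly in the window. What is left of the error is the tail of \<open>v\<close>, of
  size \<open>\<rho>\<^sup>-\<^sup>N\<^sup>/\<^sup>2\<close>, and the aliased terms \<open>v_m * g l / g m\<close> with \<open>l\<close> outside the window.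

  All estimates come from the two-sided bound \<open>\<bar>g l\<bar> \<approx> R\<^sup>-\<^sup>\<bar>\<^sup>l\<^sup>\<bar> / (\<bar>l\<bar> + 1)\<close>
  (\<open>hankel_kernel_fourier_expansion\<close>). It gives \<open>\<bar>\<beta> m\<bar> \<lesssim> (\<bar>m\<bar> + 1) * (R/\<rho>)\<^sup>\<bar>\<^sup>m\<^sup>\<bar>\<close>, which is
  summable because \<open>R < \<rho>\<close>, and so the coefficient norms stay bounded. By Parseval the squared
  error is at most a constant times \<open>\<rho>\<^sup>-\<^sup>N + R\<^sup>-\<^sup>2\<^sup>N * (\<Sum>m. (R\<^sup>2/\<rho>)\<^sup>2\<^sup>\<bar>\<^sup>m\<^sup>\<bar>)\<close>, the sum running over
  the window (\<open>boundary_error_sq_bound\<close>). The three regimes are those of this geometric sum: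
  dominated by its last term, of \<open>N\<close> equal terms, or bounded (\<open>convergence_rate\<close>).

  The kernel coefficients are computed without the general theory of Bessel functions. As a
  function of \<open>s\<close>, \<open>H_0(k \<surd>s)\<close> extends to a holomorphic \<open>f\<close> on the plane cut along the negative
  reals, where \<open>s f'' + f' + \<kappa> f = 0\<close> with \<open>\<kappa> = k\<^sup>2/4\<close>. For \<open>z\<close> on the unit circle
  \<open>\<bar>z - R\<bar>\<^sup>2 = (R - z)(R - cnj z)\<close>, and \<open>f((R - p)(R - q))\<close> is holomorphic for \<open>\<bar>p\<bar>, \<bar>q\<bar> < R\<close>.
  The differential equation turns into the recurrence
  \<open>(n+1)(m+1) b\<^sub>n\<^sub>+\<^sub>1\<^sub>,\<^sub>m\<^sub>+\<^sub>1 = - \<kappa> b\<^sub>n\<^sub>,\<^sub>m\<close> for its Taylor coefficients. Hence the coefficients with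
  \<open>\<bar>m - n\<bar> = l\<close> are multiples of \<open>f\<^sup>(\<^sup>l\<^sup>)(R\<^sup>2)\<close>, and \<open>g l\<close> factors as the power series of
  \<open>J_l(k)\<close> times \<open>f\<^sup>(\<^sup>l\<^sup>)(R\<^sup>2)\<close> (\<open>addition_theorem\<close>), which is Graf's addition theorem. The first
  factor does not vanish because \<open>k\<^sup>2\<close> is not an eigenvalue. For the second, differentiating the
  equation gives a three-term recurrence for \<open>f\<^sup>(\<^sup>l\<^sup>)(R\<^sup>2)\<close>: the recurrence itself bounds the
  derivatives from above, and its Casoratian (the discrete Wronskian) with a rapidly decaying
  solution bounds them from below (\<open>higher_deriv_hankel_sq_bounds\<close>).
\<close>

section \<open>Trigonometric series on the unit circle\<close>

lemma integral_complex_of_real_interval: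
  fixes f :: "real \<Rightarrow> real"
  assumes "continuous_on {a..b} f"
  shows "integral {a..b} (\<lambda>x. complex_of_real (f x)) = of_real (integral {a..b} f)"
  using has_integral_of_real[OF integrable_integral[OF integrable_continuous_interval[OF assms]]]
  by (rule integral_unique)

lemma integral_cnj_interval:
  assumes "continuous_on {a..b} f"
  shows "integral {a..b} (\<lambda>x. cnj (f x)) = cnj (integral {a..b::real} f)"
  using integral_linear[OF integrable_continuous_interval[OF assms] bounded_linear_cnj] by (simp add: o_def)

lemma integral_cis_int:
  "integral {0..2*pi} (\<lambda>\<theta>. cis (of_int m * \<theta>)) = (if m = 0 then of_real (2 * pi) else 0)"
proof (cases "m = 0")
  case False
  have "((\<lambda>\<theta>. cis (of_int m * \<theta>)) has_integral
      cis (of_int m * (2*pi)) / (\<i> * of_int m) - cis (of_int m * 0) / (\<i> * of_int m)) {0..2*pi}"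
  proof (rule fundamental_theorem_of_calculus)
    fix x :: real
    have "((\<lambda>z. exp (\<i> * of_int m * z) / (\<i> * of_int m)) has_field_derivative exp (\<i> * of_int m * of_real x))
        (at (of_real x))"
      using False by (auto intro!: derivative_eq_intros)
    from has_vector_derivative_real_field[OF this]
    show "((\<lambda>\<theta>. cis (of_int m * \<theta>) / (\<i> * of_int m)) has_vector_derivative
        cis (of_int m * x)) (at x within {0..2*pi})"
      by (simp add: cis_conv_exp mult.assoc)
  qed simp
  moreover have "cis (of_int m * (2*pi)) = 1"
    using cis_multiple_2pi[of "of_int m"] by (simp add: mult_ac)
  ultimately show ?thesis using False by (simp add: integral_unique)
qed (simp add: scaleR_conv_of_real)

lemma cis_powi: "cis \<theta> powi m = cis (of_int m * \<theta>)"
  by (cases "m \<ge> 0") (auto simp: power_int_def Complex.DeMoivre)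

text \<open>
  An absolutely convergent trigonometric series converges uniformly, so it may be integrated
  term by term against any continuous \<open>h\<close>. Taking \<open>h\<close> to be a character isolates a coefficient;
  taking it to be the conjugate of the series itself gives Parseval's identity.
\<close>

lemma has_sum_integral_trig_series:
  fixes c :: "int \<Rightarrow> complex" and w h :: "real \<Rightarrow> complex"
  assumes c: "(\<lambda>m. norm (c m)) summable_on UNIV"
    and w: "\<And>\<theta>. ((\<lambda>m. c m * cis (of_int m * \<theta>)) has_sum w \<theta>) UNIV"
    and h: "continuous_on {0..2*pi} h"
  shows "((\<lambda>m. c m * integral {0..2*pi} (\<lambda>\<theta>. cis (of_int m * \<theta>) * h \<theta>)) has_sum
          integral {0..2*pi} (\<lambda>\<theta>. w \<theta> * h \<theta>)) UNIV"
proof -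
  obtain H where H: "\<And>\<theta>. \<theta> \<in> {0..2*pi} \<Longrightarrow> norm (h \<theta>) \<le> H"
    using compact_imp_bounded[OF compact_continuous_image[OF h]] unfolding bounded_iff by blast
  have "uniform_limit {0..2*pi} (\<lambda>X \<theta>. \<Sum>m\<in>X. c m * cis (of_int m * \<theta>) * h \<theta>)
      (\<lambda>\<theta>. w \<theta> * h \<theta>) (finite_subsets_at_top UNIV)"
  proof (rule Weierstrass_m_test_general'[where M = "\<lambda>m. norm (c m) * H"])
    fix m \<theta> assume "\<theta> \<in> {0..2*pi}"
    with H[OF this] show "norm (c m * cis (of_int m * \<theta>) * h \<theta>) \<le> norm (c m) * H"
      by (simp add: norm_mult mult_left_mono)
  next
    show "((\<lambda>m. c m * cis (of_int m * \<theta>) * h \<theta>) has_sum w \<theta> * h \<theta>) UNIV" for \<theta>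
      by (rule has_sum_cmult_left[OF w])
  next
    show "(\<lambda>m. norm (c m) * H) summable_on UNIV" by (rule summable_on_cmult_left[OF c])
  qed
  then obtain I J where IJ:
      "\<And>X. ((\<lambda>\<theta>. \<Sum>m\<in>X. c m * cis (of_int m * \<theta>) * h \<theta>) has_integral I X) {0..2*pi}"
      "((\<lambda>\<theta>. w \<theta> * h \<theta>) has_integral J) {0..2*pi}"
      "(I \<longlongrightarrow> J) (finite_subsets_at_top UNIV)"
    by (rule uniform_limit_integral) (auto intro!: continuous_intros h simp: finite_subsets_at_top_neq_bot)
  have "I X = (\<Sum>m\<in>X. c m * integral {0..2*pi} (\<lambda>\<theta>. cis (of_int m * \<theta>) * h \<theta>))" if "finite X" for X
  proof -
    have "I X = integral {0..2*pi} (\<lambda>\<theta>. \<Sum>m\<in>X. c m * (cis (of_int m * \<theta>) * h \<theta>))"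
      using IJ(1)[of X] by (simp add: integral_unique mult.assoc)
    also have "\<dots> = (\<Sum>m\<in>X. integral {0..2*pi} (\<lambda>\<theta>. c m * (cis (of_int m * \<theta>) * h \<theta>)))"
      using that
      by (intro integral_sum integrable_continuous_interval) (auto intro!: continuous_intros h)
    finally show ?thesis by simp
  qed
  then have "\<forall>\<^sub>F X in finite_subsets_at_top UNIV. I X = (\<Sum>m\<in>X. c m * integral {0..2*pi} (\<lambda>\<theta>. cis (of_int m * \<theta>) * h \<theta>))"
    by (intro eventually_finite_subsets_at_top_weakI) auto
  from tendsto_cong[OF this] show ?thesis
    using IJ(2,3) by (simp add: has_sum_def integral_unique)
qed

lemma integral_trig_series_coeff:
  fixes c :: "int \<Rightarrow> complex" and w :: "real \<Rightarrow> complex"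
  assumes c: "(\<lambda>m. norm (c m)) summable_on UNIV"
    and w: "\<And>\<theta>. ((\<lambda>m. c m * cis (of_int m * \<theta>)) has_sum w \<theta>) UNIV"
  shows "integral {0..2*pi} (\<lambda>\<theta>. w \<theta> * cis (- (of_int n * \<theta>))) = of_real (2 * pi) * c n"
proof -
  have "((\<lambda>m. c m * integral {0..2*pi} (\<lambda>\<theta>. cis (of_int m * \<theta>) * cis (- (of_int n * \<theta>)))) has_sum
          integral {0..2*pi} (\<lambda>\<theta>. w \<theta> * cis (- (of_int n * \<theta>)))) UNIV"
    by (rule has_sum_integral_trig_series[OF c w]) (auto intro!: continuous_intros)
  moreover have "cis (of_int m * \<theta>) * cis (- (of_int n * \<theta>)) = cis (of_int (m - n) * \<theta>)" for m \<theta>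
    by (simp add: cis_mult algebra_simps)
  ultimately have "((\<lambda>m. c m * (if m - n = 0 then of_real (2 * pi) else 0)) has_sum
          integral {0..2*pi} (\<lambda>\<theta>. w \<theta> * cis (- (of_int n * \<theta>)))) UNIV"
    by (simp only: integral_cis_int)
  moreover have "((\<lambda>m. c m * (if m - n = 0 then of_real (2 * pi) else 0)) has_sum of_real (2 * pi) * c n) UNIV"
    by (rule has_sum_finite_neutralI[where B="{n}"]) auto
  ultimately show ?thesis by (rule has_sum_unique)
qed

lemma parseval_trig_series:
  fixes c :: "int \<Rightarrow> complex" and w :: "real \<Rightarrow> complex"
  assumes c: "(\<lambda>m. norm (c m)) summable_on UNIV"
    and w: "\<And>\<theta>. ((\<lambda>m. c m * cis (of_int m * \<theta>)) has_sum w \<theta>) UNIV"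
  shows "((\<lambda>m. 2 * pi * (norm (c m))\<^sup>2) has_sum integral {0..2*pi} (\<lambda>\<theta>. (norm (w \<theta>))\<^sup>2)) UNIV"
proof -
  have "uniform_limit {0..2*pi} (\<lambda>X \<theta>. \<Sum>m\<in>X. c m * cis (of_int m * \<theta>)) w (finite_subsets_at_top UNIV)"
    by (rule Weierstrass_m_test_general'[OF _ w c]) (simp add: norm_mult)
  then have cw: "continuous_on {0..2*pi} w"
    by (rule uniform_limit_theorem[rotated])
       (auto intro!: continuous_intros always_eventually simp: finite_subsets_at_top_neq_bot)
  have "((\<lambda>m. c m * integral {0..2*pi} (\<lambda>\<theta>. cis (of_int m * \<theta>) * cnj (w \<theta>))) has_sum
          integral {0..2*pi} (\<lambda>\<theta>. w \<theta> * cnj (w \<theta>))) UNIV"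
    by (rule has_sum_integral_trig_series[OF c w]) (auto intro!: continuous_intros cw)
  moreover have "integral {0..2*pi} (\<lambda>\<theta>. cis (of_int m * \<theta>) * cnj (w \<theta>)) = cnj (of_real (2 * pi) * c m)" for m
    unfolding integral_trig_series_coeff[OF c w, symmetric]
    by (subst integral_cnj_interval[symmetric]) (auto intro!: continuous_intros cw simp: cis_cnj mult.commute[of "cnj _"])
  moreover have "c m * cnj (of_real (2 * pi) * c m) = of_real (2 * pi * (norm (c m))\<^sup>2)" for m
    by (simp add: complex_norm_square[of "c m"] mult_ac del: of_real_power)
  moreover have "integral {0..2*pi} (\<lambda>\<theta>. w \<theta> * cnj (w \<theta>)) = of_real (integral {0..2*pi} (\<lambda>\<theta>. (norm (w \<theta>))\<^sup>2))"
    unfolding complex_norm_square[symmetric]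
    by (rule integral_complex_of_real_interval) (intro continuous_intros cw)
  ultimately show ?thesis by (simp only: has_sum_of_real_iff)
qed

text \<open>
  Completeness of the characters is reduced to the Stone-Weierstrass theorem. The orthogonality
  condition is formulated for a variable \<open>D\<close> because it is then preserved when \<open>D\<close> is multiplied by
  \<open>Re z\<close> or \<open>Im z\<close>, which merely shift the frequencies by one, and hence by any real polynomial.
\<close>

definition orthogonal_to_characters :: "(real \<Rightarrow> complex) \<Rightarrow> bool" where
  "orthogonal_to_characters D \<longleftrightarrow> continuous_on {0..2*pi} D \<and>
     (\<forall>m::int. integral {0..2*pi} (\<lambda>\<theta>. D \<theta> * cis (of_int m * \<theta>)) = 0)"

lemma orthogonal_mult_polynomial:
  assumes "real_polynomial_function (p :: complex \<Rightarrow> real)" "orthogonal_to_characters D"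
  shows "orthogonal_to_characters (\<lambda>\<theta>. D \<theta> * of_real (p (cis \<theta>)))"
  using assms
proof (induction arbitrary: D rule: real_polynomial_function.induct)
  case (linear f)
  have c: "continuous_on {0..2*pi} D" using linear by (simp add: orthogonal_to_characters_def)
  \<comment> \<open>a real-linear function restricted to the circle is a combination of \<open>e\<^sup>i\<^sup>\<theta>\<close> and \<open>e\<^sup>-\<^sup>i\<^sup>\<theta>\<close>\<close>
  define a b where "a = (of_real (f 1) - \<i> * of_real (f \<i>)) / 2" and "b = (of_real (f 1) + \<i> * of_real (f \<i>)) / 2"
  have f: "of_real (f (cis \<theta>)) = a * cis \<theta> + b * cis (- \<theta>)" for \<theta>
  proof -
    interpret bounded_linear f by fact
    have "cis \<theta> = cos \<theta> *\<^sub>R 1 + sin \<theta> *\<^sub>R \<i>" by (simp add: complex_eq_iff)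
    then have "f (cis \<theta>) = cos \<theta> * f 1 + sin \<theta> * f \<i>" by (simp only: add scaleR) simp
    then show ?thesis by (simp add: a_def b_def complex_eq_iff field_simps)
  qed
  have "integral {0..2*pi} (\<lambda>\<theta>. D \<theta> * of_real (f (cis \<theta>)) * cis (of_int m * \<theta>)) = 0" for m
  proof -
    have "D \<theta> * of_real (f (cis \<theta>)) * cis (of_int m * \<theta>)
       = a * (D \<theta> * cis (of_int (m + 1) * \<theta>)) + b * (D \<theta> * cis (of_int (m - 1) * \<theta>))" for \<theta>
    proof -
      have eq: "cis \<theta> * cis (of_int m * \<theta>) = cis (of_int (m + 1) * \<theta>)"
        "cis (-\<theta>) * cis (of_int m * \<theta>) = cis (of_int (m - 1) * \<theta>)"
        by (simp_all add: cis_mult algebra_simps)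
      then show ?thesis unfolding f eq[symmetric] by (simp add: algebra_simps)
    qed
    moreover have "integral {0..2*pi} (\<lambda>\<theta>. a * (D \<theta> * cis (of_int (m + 1) * \<theta>)) + b * (D \<theta> * cis (of_int (m - 1) * \<theta>)))
       = a * integral {0..2*pi} (\<lambda>\<theta>. D \<theta> * cis (of_int (m + 1) * \<theta>)) + b * integral {0..2*pi} (\<lambda>\<theta>. D \<theta> * cis (of_int (m - 1) * \<theta>))"
      by (subst integral_add) (auto intro!: integrable_continuous_interval continuous_intros c)
    ultimately show ?thesis
      using linear(2) by (simp add: orthogonal_to_characters_def del: of_int_add of_int_diff)
  qed
  moreover have "continuous_on {0..2*pi} (\<lambda>\<theta>. D \<theta> * of_real (f (cis \<theta>)))"
    unfolding f by (auto intro!: continuous_intros c)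
  ultimately show ?case by (simp add: orthogonal_to_characters_def)
next
  case (const c)
  have "(\<lambda>\<theta>. D \<theta> * of_real c * cis (of_int m * \<theta>)) = (\<lambda>\<theta>. of_real c * (D \<theta> * cis (of_int m * \<theta>)))" for m
    by (simp add: mult_ac)
  with const show ?case by (auto simp: orthogonal_to_characters_def intro!: continuous_intros)
next
  case (add f g)
  let ?F = "\<lambda>\<theta>. D \<theta> * of_real (f (cis \<theta>))" and ?G = "\<lambda>\<theta>. D \<theta> * of_real (g (cis \<theta>))"
  have F: "orthogonal_to_characters ?F" and G: "orthogonal_to_characters ?G" using add by auto
  have "integral {0..2*pi} (\<lambda>\<theta>. ?F \<theta> * cis (of_int m * \<theta>) + ?G \<theta> * cis (of_int m * \<theta>)) = 0" for m
    using F G unfolding orthogonal_to_characters_def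
    by (subst integral_add) (auto intro!: integrable_continuous_interval continuous_intros)
  moreover have "continuous_on {0..2*pi} (\<lambda>\<theta>. ?F \<theta> + ?G \<theta>)"
    using F G unfolding orthogonal_to_characters_def by (auto intro!: continuous_on_add)
  ultimately show ?case unfolding orthogonal_to_characters_def by (simp add: algebra_simps)
next
  case (mult f g)
  from mult.IH(2)[OF mult.IH(1)[OF mult.prems]] show ?case by (simp add: mult_ac)
qed

text \<open>
  Let \<open>g\<close> be a polynomial within \<open>e\<close> of \<open>d\<close> on the circle. As \<open>d\<close> is orthogonal to \<open>g\<close>, the
  integral of \<open>\<bar>d\<bar>\<^sup>2\<close> equals that of \<open>d * cnj (d - g)\<close>, which is at most \<open>e\<close> times that of \<open>\<bar>d\<bar>\<close>.
\<close>

lemma orthogonal_to_characters_imp_zero: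
  fixes d :: "complex \<Rightarrow> complex"
  assumes d: "continuous_on (sphere 0 1) d"
    and orth: "\<And>m::int. integral {0..2*pi} (\<lambda>\<theta>. d (cis \<theta>) * cis (of_int m * \<theta>)) = 0"
    and \<theta>: "\<theta> \<in> {0..2*pi}"
  shows "d (cis \<theta>) = 0"
proof -
  have c: "continuous_on {0..2*pi} (\<lambda>\<theta>. d (cis \<theta>))"
    by (rule continuous_on_compose2[OF d]) (auto intro!: continuous_intros)
  have D: "orthogonal_to_characters (\<lambda>\<theta>. d (cis \<theta>))"
    using c orth by (simp add: orthogonal_to_characters_def)
  define I where "I = integral {0..2*pi} (\<lambda>\<theta>. (norm (d (cis \<theta>)))\<^sup>2)"
  define L where "L = integral {0..2*pi} (\<lambda>\<theta>. norm (d (cis \<theta>)))"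
  have small: "I \<le> e * L" if "e > 0" for e
  proof -
    obtain g where g: "polynomial_function g" and ge: "\<And>z. z \<in> sphere 0 1 \<Longrightarrow> norm (d z - g z) < e"
      using Stone_Weierstrass_polynomial_function[OF compact_sphere d \<open>e > 0\<close>] by blast
    have cg: "continuous_on {0..2*pi} (\<lambda>\<theta>. g (cis \<theta>))"
      using continuous_on_polymonial_function[OF g] by (rule continuous_on_compose2) (auto intro!: continuous_intros)
    have re: "orthogonal_to_characters (\<lambda>\<theta>. d (cis \<theta>) * of_real (Re (g (cis \<theta>))))"
      using orthogonal_mult_polynomial[OF _ D, of "Re \<circ> g"] g
      by (auto simp: polynomial_function_def bounded_linear_Re)
    have im: "orthogonal_to_characters (\<lambda>\<theta>. d (cis \<theta>) * of_real (Im (g (cis \<theta>))))"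
      using orthogonal_mult_polynomial[OF _ D, of "Im \<circ> g"] g
      by (auto simp: polynomial_function_def bounded_linear_Im)
    have re0: "integral {0..2*pi} (\<lambda>\<theta>. d (cis \<theta>) * of_real (Re (g (cis \<theta>)))) = 0"
      using re[unfolded orthogonal_to_characters_def, THEN conjunct2, rule_format, of 0] by simp
    have im0: "integral {0..2*pi} (\<lambda>\<theta>. d (cis \<theta>) * of_real (Im (g (cis \<theta>)))) = 0"
      using im[unfolded orthogonal_to_characters_def, THEN conjunct2, rule_format, of 0] by simp
    have "integral {0..2*pi} (\<lambda>\<theta>. d (cis \<theta>) * of_real (Re (g (cis \<theta>))) - \<i> * (d (cis \<theta>) * of_real (Im (g (cis \<theta>))))) = 0"
      using re im unfolding orthogonal_to_characters_def
      by (subst integral_diff) (auto simp: re0 im0 intro!: integrable_continuous_interval continuous_intros)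
    moreover have "d (cis \<theta>) * of_real (Re (g (cis \<theta>))) - \<i> * (d (cis \<theta>) * of_real (Im (g (cis \<theta>)))) = d (cis \<theta>) * cnj (g (cis \<theta>))" for \<theta>
      by (simp add: complex_eq_iff algebra_simps)
    ultimately have g0: "integral {0..2*pi} (\<lambda>\<theta>. d (cis \<theta>) * cnj (g (cis \<theta>))) = 0" by simp
    have "of_real I = integral {0..2*pi} (\<lambda>\<theta>. d (cis \<theta>) * cnj (d (cis \<theta>)))"
      unfolding complex_norm_square[symmetric] I_def
      by (rule integral_complex_of_real_interval[symmetric]) (intro continuous_intros c)
    also have "\<dots> = integral {0..2*pi} (\<lambda>\<theta>. d (cis \<theta>) * cnj (d (cis \<theta>)) - d (cis \<theta>) * cnj (g (cis \<theta>)))"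
      by (subst integral_diff) (auto simp: g0 intro!: integrable_continuous_interval continuous_intros c cg)
    finally have "\<bar>I\<bar> = norm (integral {0..2*pi} (\<lambda>\<theta>. d (cis \<theta>) * cnj (d (cis \<theta>)) - d (cis \<theta>) * cnj (g (cis \<theta>))))"
      by (metis norm_of_real)
    also have "\<dots> \<le> integral {0..2*pi} (\<lambda>\<theta>. e * norm (d (cis \<theta>)))"
    proof (rule integral_norm_bound_integral)
      fix \<theta> :: real
      have "norm (d (cis \<theta>) * cnj (d (cis \<theta>)) - d (cis \<theta>) * cnj (g (cis \<theta>))) = norm (d (cis \<theta>)) * norm (d (cis \<theta>) - g (cis \<theta>))"
        by (metis complex_cnj_diff complex_mod_cnj norm_mult right_diff_distrib)
      also have "\<dots> \<le> norm (d (cis \<theta>)) * e"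
        using ge[of "cis \<theta>"] by (intro mult_left_mono) auto
      finally show "norm (d (cis \<theta>) * cnj (d (cis \<theta>)) - d (cis \<theta>) * cnj (g (cis \<theta>))) \<le> e * norm (d (cis \<theta>))"
        by (simp add: mult.commute)
    qed (auto intro!: integrable_continuous_interval continuous_intros c cg)
    finally show "I \<le> e * L" by (simp add: L_def)
  qed
  have "((\<lambda>e. e * L) \<longlongrightarrow> 0 * L) (at_right 0)" by (intro tendsto_intros)
  then have "I \<le> 0 * L"
    by (rule tendsto_lowerbound) (auto simp: eventually_at_right_less small eventually_at_filter)
  moreover have "I \<ge> 0" unfolding I_def by (rule integral_nonneg) (auto intro!: integrable_continuous_interval continuous_intros c)
  ultimately have "I = 0" by simp
  then have "((\<lambda>\<theta>. (norm (d (cis \<theta>)))\<^sup>2) has_integral 0) (cbox 0 (2*pi))"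
    unfolding I_def
    using integrable_integral[OF integrable_continuous_interval, of 0 "2*pi" "\<lambda>\<theta>. (norm (d (cis \<theta>)))\<^sup>2"] c
    by (simp add: continuous_intros)
  then have "(norm (d (cis \<theta>)))\<^sup>2 = 0"
    by (rule has_integral_0_cbox_imp_0[rotated 2]) (use \<theta> pi_gt_zero in \<open>auto intro!: continuous_intros c simp del: pi_gt_zero\<close>)
  then show ?thesis by simp
qed

text \<open>
  The Fourier series has a continuous sum with the same Fourier coefficients as \<open>v\<close>, so the
  difference is orthogonal to all characters and vanishes.
\<close>

lemma fourier_series_has_sum:
  assumes v: "continuous_on (sphere 0 1) v"
    and c: "(\<lambda>m. norm (fourier_coeff v m)) summable_on UNIV"
  shows "((\<lambda>m. fourier_coeff v m * cis (of_int m * \<theta>)) has_sum v (cis \<theta>)) UNIV"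
proof -
  let ?c = "fourier_coeff v"
  define V where "V z = (\<Sum>\<^sub>\<infinity>m. ?c m * z powi m)" for z
  have bound: "norm (?c m * z powi m) \<le> norm (?c m)" if "z \<in> sphere 0 1" for m z
    using that by (simp add: norm_mult norm_power_int)
  have V: "((\<lambda>m. ?c m * z powi m) has_sum V z) UNIV" if "z \<in> sphere 0 1" for z
    unfolding V_def
    by (rule has_sum_infsum, rule Infinite_Sum.abs_summable_summable, rule Infinite_Sum.abs_summable_on_comparison_test'[OF c])
       (use that bound in blast)
  have "uniform_limit (sphere 0 1) (\<lambda>X z. \<Sum>m\<in>X. ?c m * z powi m) V (finite_subsets_at_top UNIV)"
    by (rule Weierstrass_m_test_general'[OF bound V c])
  then have cV: "continuous_on (sphere 0 1) V"
    by (rule uniform_limit_theorem[rotated])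
       (auto intro!: continuous_intros always_eventually simp: finite_subsets_at_top_neq_bot)
  have W: "((\<lambda>m. ?c m * cis (of_int m * \<theta>)) has_sum V (cis \<theta>)) UNIV" for \<theta>
    using V[of "cis \<theta>"] by (simp add: cis_powi)
  have cc: "continuous_on {0..2*pi} (\<lambda>\<theta>. u (cis \<theta>))" if "continuous_on (sphere 0 1) u" for u :: "complex \<Rightarrow> complex"
    by (rule continuous_on_compose2[OF that]) (auto intro!: continuous_intros)
  have z: "v (cis \<theta>) - V (cis \<theta>) = 0" if "\<theta> \<in> {0..2*pi}" for \<theta>
  proof (rule orthogonal_to_characters_imp_zero[of "\<lambda>z. v z - V z", OF _ _ that])
    fix m :: int
    have "integral {0..2*pi} (\<lambda>\<theta>. v (cis \<theta>) * cis (- (of_int (-m) * \<theta>)) - V (cis \<theta>) * cis (- (of_int (-m) * \<theta>))) = 0"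
      unfolding integral_trig_series_coeff[OF c W]
      by (subst integral_diff)
         (auto intro!: integrable_continuous_interval continuous_intros cc v cV
               simp: integral_trig_series_coeff[OF c W, of "-m", simplified] fourier_coeff_def)
    then show "integral {0..2*pi} (\<lambda>\<theta>. (v (cis \<theta>) - V (cis \<theta>)) * cis (of_int m * \<theta>)) = 0"
      by (simp add: algebra_simps)
  qed (intro continuous_intros v cV)
  obtain t where "t \<in> {0..2*pi}" "cis t = cis \<theta>"
  proof -
    have "cis (Arg2pi (cis \<theta>)) = cis \<theta>" 
      using Arg2pi_eq[of "cis \<theta>"] by (simp add: cis_conv_exp)
    then show ?thesis using that[of "Arg2pi (cis \<theta>)"] Arg2pi_ge_0 Arg2pi_lt_2pi less_imp_le by auto
  qed
  with z[of t] W[of \<theta>] show ?thesis by simp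
qed

section \<open>Power series of Bessel type\<close>

lemma entire_fps_of_fact_bound:
  fixes f :: "complex fps"
  assumes "\<And>n. norm (fps_nth f n) \<le> C / fact n"
  shows "fps_conv_radius f = \<infinity>" and "norm (eval_fps f z) \<le> C * exp (norm z)"
proof -
  have exps: "(\<lambda>n. C * (norm w ^ n / fact n)) sums (C * exp (norm w))" for w :: complex
    using exp_converges[of "norm w"] by (intro sums_mult) (simp add: divide_inverse mult.commute)
  have bd: "norm (fps_nth f n * w ^ n) \<le> C * (norm w ^ n / fact n)" for n w
    using mult_right_mono[OF assms[of n], of "norm w ^ n"] by (simp add: norm_mult norm_power)
  have sm: "summable (\<lambda>n. norm (fps_nth f n * w ^ n))" for w
    by (rule summable_comparison_test_ev[OF _ sums_summable[OF exps[of w]]]) (use bd in auto)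
  show "fps_conv_radius f = \<infinity>"
    unfolding fps_conv_radius_def by (rule conv_radius_inftyI'') (rule summable_norm_cancel[OF sm])
  have "norm (eval_fps f z) \<le> (\<Sum>n. norm (fps_nth f n * z ^ n))"
    unfolding eval_fps_def by (rule summable_norm[OF sm])
  also have "\<dots> \<le> (\<Sum>n. C * (norm z ^ n / fact n))"
    by (rule suminf_le[OF bd sm sums_summable[OF exps]])
  also have "\<dots> = C * exp (norm z)" by (rule sums_unique[OF exps, symmetric])
  finally show "norm (eval_fps f z) \<le> C * exp (norm z)" .
qed

text \<open>
  The Bessel-Clifford functions: \<open>J_m(x) = (x/2)\<^sup>m * clifford m (-x\<^sup>2/4)\<close>. They are entire, each
  is the derivative of the preceding one, and they avoid the powers \<open>(x/2)\<^sup>m\<close>.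
\<close>

definition clifford_fps :: "nat \<Rightarrow> complex fps" where
  "clifford_fps m = Abs_fps (\<lambda>n. 1 / (fact n * fact (n + m)))"

definition clifford :: "nat \<Rightarrow> complex \<Rightarrow> complex" where
  "clifford m = eval_fps (clifford_fps m)"

lemma fact_mult_fact_le: "fact m * fact n \<le> (fact (n + m) :: real)"
proof -
  have "fact n * fact m \<le> (fact (n + m) :: nat)" by (rule dvd_imp_le[OF fact_fact_dvd_fact]) simp
  then have "real (fact n * fact m) \<le> real (fact (n + m))" by (rule of_nat_mono)
  then show ?thesis by (simp add: mult.commute)
qed

lemma norm_clifford_coeff_le: "norm (fps_nth (clifford_fps m) n) \<le> (1 / fact m) / fact n"
proof -
  have "fact m * fact n * 1 \<le> (fact (n + m) :: real) * fact n"
    using fact_mult_fact_le[of m n] fact_ge_1[of n, where 'a=real] by (intro mult_mono) auto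
  then show ?thesis by (simp add: clifford_fps_def norm_divide norm_mult field_simps)
qed

lemmas clifford_fps_radius = entire_fps_of_fact_bound(1)[OF norm_clifford_coeff_le]

lemma norm_clifford_le: "norm (clifford m z) \<le> exp (norm z) / fact m"
  using entire_fps_of_fact_bound(2)[OF norm_clifford_coeff_le, of m z] by (simp add: clifford_def)

lemma clifford_sums: "(\<lambda>n. z ^ n / (fact n * fact (n + m))) sums clifford m z"
  using sums_eval_fps[of z "clifford_fps m", unfolded clifford_fps_radius]
  by (simp add: clifford_def clifford_fps_def)

lemma clifford_at_0: "clifford m 0 = 1 / fact m"
  by (simp add: clifford_def eval_fps_at_0 clifford_fps_def)

lemma fps_deriv_clifford: "fps_deriv (clifford_fps m) = clifford_fps (Suc m)"
  by (rule fps_ext) (simp add: clifford_fps_def field_simps del: of_nat_Suc)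

lemma has_field_derivative_clifford [derivative_intros]:
  "(f has_field_derivative f') (at z within A) \<Longrightarrow>
   ((\<lambda>z. clifford m (f z)) has_field_derivative (clifford (Suc m) (f z) * f')) (at z within A)"
  unfolding clifford_def fps_deriv_clifford[symmetric]
  by (rule DERIV_chain2[OF has_field_derivative_eval_fps]) (simp_all add: clifford_fps_radius)

text \<open>
  For \<open>m = 0\<close> this is the differential equation of \<open>clifford 0\<close>; in general it is the three-term
  recurrence of the Bessel functions.
\<close>

lemma clifford_recurrence:
  "z * clifford (m + 2) z + of_nat (m + 1) * clifford (m + 1) z = clifford m z"
proof -
  have "fps_X * clifford_fps (m + 2) + fps_const (of_nat (m + 1)) * clifford_fps (m + 1) = clifford_fps m"
  proof (rule fps_ext)
    fix n
    show "fps_nth (fps_X * clifford_fps (m + 2) + fps_const (of_nat (m + 1)) * clifford_fps (m + 1)) n =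
      fps_nth (clifford_fps m) n"
    proof (cases n)
      case (Suc j)
      define p q :: complex where "p = of_nat (Suc j)" and "q = of_nat (Suc (j + m + 1))"
      have nz: "p \<noteq> 0" "q \<noteq> 0" unfolding p_def q_def by (simp_all only: of_nat_eq_0_iff)
      have q: "of_nat (m + 1) = q - p" by (simp add: p_def q_def)
      have "fact (j + (m + 2)) = q * fact (j + m + 1)" "fact (Suc j + (m + 1)) = q * fact (j + m + 1)"
        "fact (Suc j + m) = (fact (j + m + 1) :: complex)" "fact (Suc j) = p * fact j"
        by (simp_all add: p_def q_def add_ac)
      then have "fps_nth (fps_X * clifford_fps (m + 2) + fps_const (of_nat (m + 1)) * clifford_fps (m + 1)) n
          = 1 / (fact j * (q * fact (j + m + 1))) + (q - p) * (1 / (p * fact j * (q * fact (j + m + 1))))"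
        "fps_nth (clifford_fps m) n = 1 / (p * fact j * fact (j + m + 1))"
        unfolding Suc clifford_fps_def q[symmetric] by (simp_all del: fact_Suc)
      moreover have "1 / (A * (q * F)) + (q - p) * (1 / (p * A * (q * F))) = 1 / (p * A * F)" if "A \<noteq> 0" "F \<noteq> 0" for A F
        using nz that by (simp add: divide_simps)
      from this[of "fact j" "fact (j + m + 1)"] have "1 / (fact j * (q * fact (j + m + 1))) + (q - p) * (1 / (p * fact j * (q * fact (j + m + 1)))) = 1 / (p * fact j * fact (j + m + 1))"
        by (simp only: fact_nonzero not_False_eq_True)
      ultimately show ?thesis by (simp only:)
    qed (simp add: clifford_fps_def del: of_nat_Suc)
  qed
  then have "eval_fps (fps_X * clifford_fps (m + 2) + fps_const (of_nat (m + 1)) * clifford_fps (m + 1)) z = clifford m z"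
    by (simp only: clifford_def)
  moreover have "fps_conv_radius (fps_X * clifford_fps (m + 2)) = \<infinity>"
    using fps_conv_radius_mult[of fps_X "clifford_fps (m + 2)"] by (simp add: clifford_fps_radius)
  moreover have "fps_conv_radius (fps_const (of_nat (m + 1)) * clifford_fps (m + 1)) = \<infinity>"
    using fps_conv_radius_mult[of "fps_const (of_nat (m + 1))" "clifford_fps (m + 1)"] by (simp add: clifford_fps_radius)
  ultimately show ?thesis
    by (simp add: eval_fps_add eval_fps_mult clifford_fps_radius clifford_def)
qed

text \<open>
  The leading term dominates for large order: \<open>J_m(x)\<close> is asymptotic to \<open>(x/2)\<^sup>m / m!\<close>.
\<close>

lemma norm_fact_clifford_minus_1_le: "norm (fact m * clifford m z - 1) \<le> exp (norm z) / (real m + 1)"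
proof -
  have "(\<lambda>n. fact m * (z ^ n / (fact n * fact (n + m)))) sums (fact m * clifford m z)"
    by (intro sums_mult clifford_sums)
  from sums_split_initial_segment[OF this, of 1]
  have s: "(\<lambda>n. fact m * (z ^ Suc n / (fact (Suc n) * fact (Suc n + m)))) sums (fact m * clifford m z - 1)"
    by simp
  have e: "(\<lambda>n. norm z ^ Suc n / fact (Suc n) / (real m + 1)) sums ((exp (norm z) - 1) / (real m + 1))"
    using sums_split_initial_segment[OF exp_converges[of "norm z"], of 1]
    by (intro sums_divide) (simp add: divide_inverse mult.commute)
  have bd: "norm (fact m * (z ^ Suc n / (fact (Suc n) * fact (Suc n + m)))) \<le> norm z ^ Suc n / fact (Suc n) / (real m + 1)" for n
  proof -
    have "(1::nat) * fact (Suc m) \<le> fact (Suc n + m)" by (simp add: fact_mono del: fact_Suc)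
    then have "fact (Suc m) \<le> (fact (Suc n + m) :: real)"
      by (simp only: mult_1 of_nat_fact[symmetric, where 'a=real] of_nat_le_iff)
    then have "fact m * (real m + 1) \<le> (fact (Suc n + m) :: real)" by (simp add: algebra_simps)
    moreover have "real m + 1 > 0" by linarith
    ultimately have "fact m / (fact (Suc n + m) :: real) \<le> 1 / (real m + 1)" by (simp add: pos_le_divide_eq field_simps del: fact_Suc)
    then have "norm z ^ Suc n / fact (Suc n) * (fact m / fact (Suc n + m)) \<le> norm z ^ Suc n / fact (Suc n) * (1 / (real m + 1))"
      by (intro mult_left_mono) (auto simp del: fact_Suc)
    then show ?thesis by (simp add: norm_mult norm_divide norm_power mult_ac del: fact_Suc)
  qed
  have "norm (fact m * clifford m z - 1) \<le> (exp (norm z) - 1) / (real m + 1)"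
    using norm_suminf_le[OF bd sums_summable[OF e]] unfolding sums_unique[OF s, symmetric] sums_unique[OF e, symmetric] .
  also have "\<dots> \<le> exp (norm z) / (real m + 1)" by (intro divide_right_mono) auto
  finally show ?thesis .
qed

lemma Reals_eval_fps:
  assumes "fps_conv_radius f = \<infinity>" "\<And>n. fps_nth f n \<in> \<real>" "x \<in> \<real>"
  shows "eval_fps f x \<in> (\<real> :: complex set)"
proof -
  have "(\<lambda>n. fps_nth f n * x ^ n) sums eval_fps f x" using assms(1) by (intro sums_eval_fps) simp
  then have "(\<lambda>n. Im (fps_nth f n * x ^ n)) sums Im (eval_fps f x)" by (rule sums_Im)
  moreover have "Im (fps_nth f n * x ^ n) = 0" for n
    using assms(2,3) by (metis Reals_mult Reals_power complex_is_Real_iff)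
  ultimately have "Im (eval_fps f x) = 0" by (simp add: sums_iff)
  then show ?thesis by (simp add: complex_is_Real_iff)
qed

lemma bessel_J_clifford:
  assumes "x > 0"
  shows "of_real (bessel_J (int m) x) = of_real ((x / 2) ^ m) * clifford m (- of_real (x\<^sup>2 / 4))"
proof -
  have "(\<lambda>n. of_real ((x / 2) ^ m) * ((- of_real (x\<^sup>2 / 4)) ^ n / (fact n * fact (n + m)))) sums
        (of_real ((x / 2) ^ m) * clifford m (- of_real (x\<^sup>2 / 4)))"
    by (intro sums_mult clifford_sums)
  moreover have "of_real ((x / 2) ^ m) * ((- of_real (x\<^sup>2 / 4)) ^ n / (fact n * fact (n + m)))
      = complex_of_real ((-1) ^ n / fact n * rGamma (of_int (int m + int n + 1)) * (x / 2) powi (2 * int n + int m))" for n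
  proof -
    have "rGamma (of_int (int m + int n + 1)) = (1 / fact (n + m) :: real)"
      using Gamma_fact[of "n + m", where 'a=real]
      by (simp add: rGamma_inverse_Gamma divide_inverse add_ac)
    moreover have "(x / 2) powi (2 * int n + int m) = (x\<^sup>2 / 4) ^ n * (x / 2) ^ m"
      using assms by (simp add: power_int_add power_int_mult power2_eq_square power_divide power_mult_distrib
          flip: power_mult)
    moreover have "(- complex_of_real (x\<^sup>2 / 4)) ^ n = of_real ((-1) ^ n * (x\<^sup>2 / 4) ^ n)"
      by (metis of_real_minus of_real_power power_minus)
    ultimately show ?thesis by simp
  qed
  ultimately have S: "(\<lambda>n. complex_of_real ((-1) ^ n / fact n * rGamma (of_int (int m + int n + 1)) * (x / 2) powi (2 * int n + int m)))
     sums (of_real ((x / 2) ^ m) * clifford m (- of_real (x\<^sup>2 / 4)))" by simp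
  then have sm: "summable (\<lambda>n. (-1) ^ n / fact n * rGamma (of_int (int m + int n + 1)) * (x / 2) powi (2 * int n + int m))"
    using sums_summable summable_of_real_iff by blast
  show ?thesis unfolding bessel_J_def suminf_of_real[OF sm] by (rule sums_unique[OF S, symmetric])
qed

text \<open>
  The entire part of the Hankel function: the power series in \<open>-x\<^sup>2/4\<close> that accompanies the
  logarithm in the expansion of \<open>Y_0\<close>.
\<close>

definition harm_fps :: "complex fps" where
  "harm_fps = Abs_fps (\<lambda>n. - of_real (harm n) / (fact n)\<^sup>2)"

lemma harm_le_fact: "harm n \<le> (fact n :: real)"
proof (induction n)
  case (Suc n)
  show ?case
  proof (cases "n = 0")
    case False
    have "harm (Suc n) \<le> fact n + (1::real)"
      using Suc inverse_le_1_iff[of "1 + real n"] by (simp add: harm_Suc)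
    also have "\<dots> \<le> fact n * (1 + real n)"
      using False fact_ge_1[of n, where 'a=real] mult_mono[of 1 "fact n :: real" 1 "real n"] by (simp add: algebra_simps)
    finally show ?thesis by (simp add: algebra_simps)
  qed (simp add: harm_def)
qed (simp add: harm_def)

lemma harm_fps_radius: "fps_conv_radius harm_fps = \<infinity>"
proof (rule entire_fps_of_fact_bound(1))
  fix n
  have "norm (fps_nth harm_fps n) = harm n / (fact n)\<^sup>2"
    by (simp add: harm_fps_def norm_divide norm_power abs_of_nonneg harm_nonneg)
  also have "\<dots> \<le> fact n / (fact n)\<^sup>2" by (intro divide_right_mono harm_le_fact) auto
  finally show "norm (fps_nth harm_fps n) \<le> 1 / fact n" by (simp add: power2_eq_square)
qed

lemma harm_fps_deriv_radius:
  "fps_conv_radius (fps_deriv harm_fps) = \<infinity>" "fps_conv_radius (fps_deriv (fps_deriv harm_fps)) = \<infinity>"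
  using fps_conv_radius_deriv[of harm_fps] fps_conv_radius_deriv[of "fps_deriv harm_fps"]
  by (auto simp: harm_fps_radius)

text \<open>
  The inhomogeneity \<open>- clifford 1\<close> is what the cross term \<open>clifford 0 * ln\<close> produces in the Bessel
  equation, so that the sum of the two parts solves the homogeneous equation.
\<close>

lemma harm_fps_ode:
  "z * eval_fps (fps_deriv (fps_deriv harm_fps)) z + eval_fps (fps_deriv harm_fps) z
     = eval_fps harm_fps z - clifford 1 z"
proof -
  have "fps_X * fps_deriv (fps_deriv harm_fps) + fps_deriv harm_fps = harm_fps - clifford_fps 1"
  proof (rule fps_ext)
    fix n
    have nz: "of_nat n + (1::complex) \<noteq> 0" by (metis add.commute of_nat_Suc of_nat_neq_0)
    then have nz': "1 + of_nat n \<noteq> (0::complex)" by (simp add: add.commute)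
    have "fps_nth (fps_X * fps_deriv (fps_deriv harm_fps) + fps_deriv harm_fps) n
       = (of_nat (Suc n))\<^sup>2 * fps_nth harm_fps (Suc n)"
      by (cases n) (simp_all add: algebra_simps power2_eq_square)
    also have "\<dots> = fps_nth (harm_fps - clifford_fps 1) n"
      using nz nz' by (simp add: harm_fps_def clifford_fps_def harm_Suc divide_simps power2_eq_square)
    finally show "fps_nth (fps_X * fps_deriv (fps_deriv harm_fps) + fps_deriv harm_fps) n = fps_nth (harm_fps - clifford_fps 1) n" .
  qed
  then have "eval_fps (fps_X * fps_deriv (fps_deriv harm_fps) + fps_deriv harm_fps) z = eval_fps (harm_fps - clifford_fps 1) z"
    by simp
  moreover have "fps_conv_radius (fps_X * fps_deriv (fps_deriv harm_fps)) = \<infinity>"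
    using fps_conv_radius_mult[of fps_X "fps_deriv (fps_deriv harm_fps)"] by (simp add: harm_fps_deriv_radius)
  ultimately show ?thesis
    by (simp add: eval_fps_add eval_fps_diff eval_fps_mult clifford_fps_radius clifford_def harm_fps_deriv_radius harm_fps_radius)
qed

text \<open>
  Up to the factor \<open>2/\<pi>\<close>, the left-hand side is \<open>s\<close> times the Wronskian of \<open>J_0(k \<surd>s)\<close> and
  \<open>Y_0(k \<surd>s)\<close> at \<open>z = -k\<^sup>2 s/4\<close>: the logarithms cancel and an entire function remains. Its derivative
  vanishes by the differential equations, so it can be evaluated at the origin.
\<close>

lemma wronskian_without_log:
  "(clifford 0 z)\<^sup>2 / 2 + z * (clifford 0 z * eval_fps (fps_deriv harm_fps) z - clifford 1 z * eval_fps harm_fps z) = 1 / 2"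
proof -
  define U where "U z = (clifford 0 z)\<^sup>2 / 2 + z * (clifford 0 z * eval_fps (fps_deriv harm_fps) z - clifford 1 z * eval_fps harm_fps z)" for z
  have "(U has_field_derivative 0) (at z)" for z
  proof -
    let ?b0 = "clifford 0 z" and ?b1 = "clifford 1 z" and ?b2 = "clifford 2 z"
    let ?E = "eval_fps harm_fps z" and ?E1 = "eval_fps (fps_deriv harm_fps) z" and ?E2 = "eval_fps (fps_deriv (fps_deriv harm_fps)) z"
    have "(U has_field_derivative (?b0 * ?b1 + (?b0 * ?E1 - ?b1 * ?E) + z * (?b0 * ?E2 - ?b2 * ?E))) (at z)"
      unfolding U_def
      by (auto intro!: derivative_eq_intros has_field_derivative_eval_fps
               simp: harm_fps_radius harm_fps_deriv_radius numeral_2_eq_2 algebra_simps)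
    moreover have "?b0 * ?b1 + (?b0 * ?E1 - ?b1 * ?E) + z * (?b0 * ?E2 - ?b2 * ?E) = 0"
    proof -
      have b: "z * ?b2 + ?b1 = ?b0" using clifford_recurrence[of z 0] by (simp add: numeral_2_eq_2)
      have "?b0 * ?b1 + (?b0 * ?E1 - ?b1 * ?E) + z * (?b0 * ?E2 - ?b2 * ?E)
        = ?b0 * ?b1 + ?b0 * (z * ?E2 + ?E1) - (z * ?b2 + ?b1) * ?E" by (simp add: algebra_simps)
      then show ?thesis unfolding b harm_fps_ode by (simp add: algebra_simps)
    qed
    ultimately show ?thesis by simp
  qed
  then obtain c where "\<forall>z\<in>UNIV. U z = c"
    using has_field_derivative_zero_constant[of UNIV U] by auto
  then have "U z = U 0" by simp
  then show ?thesis by (simp add: U_def clifford_at_0)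
qed

section \<open>The Hankel function in the variable of the squared distance\<close>

text \<open>
  The holomorphic continuation of \<open>H_0(k \<surd>s)\<close> from \<open>s > 0\<close> to the plane cut along the negative
  real axis. Using \<open>s\<close>, the square of the distance, as the variable removes all square roots and
  makes the argument a product when the distance is written in complex coordinates.
\<close>

definition hankel_sq :: "real \<Rightarrow> complex \<Rightarrow> complex" where
  "hankel_sq k s = clifford 0 (- of_real (k\<^sup>2 / 4) * s) + \<i> * of_real (2 / pi) *
     ((Ln s / 2 + of_real (ln (k / 2) + euler_mascheroni)) * clifford 0 (- of_real (k\<^sup>2 / 4) * s)
       + eval_fps harm_fps (- of_real (k\<^sup>2 / 4) * s))"

lemma hankel1_0_eq_hankel_sq:
  assumes "k > 0" "s > 0"
  shows "hankel1_0 (k * sqrt s) = hankel_sq k (of_real s)"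
proof -
  let ?x = "k * sqrt s" and ?z = "- of_real (k\<^sup>2 / 4) * of_real s :: complex"
  have x: "?x > 0" using assms by simp
  have x2: "?x\<^sup>2 / 4 = k\<^sup>2 / 4 * s" using assms by (simp add: power_mult_distrib)
  have J: "of_real (bessel_J 0 ?x) = clifford 0 ?z"
    using bessel_J_clifford[OF x, of 0] unfolding x2 by simp
  have L: "Ln (of_real s) / 2 + of_real (ln (k / 2) + euler_mascheroni) = complex_of_real (ln (?x / 2) + euler_mascheroni)"
    using assms by (simp add: Ln_of_real ln_mult ln_div ln_sqrt)
  have S: "(\<lambda>n. complex_of_real ((-1) ^ (n + 1) * harm n / (fact n)\<^sup>2 * (?x\<^sup>2 / 4) ^ n)) sums eval_fps harm_fps ?z"
  proof -
    have "(\<lambda>n. fps_nth harm_fps n * ?z ^ n) sums eval_fps harm_fps ?z"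
      by (rule sums_eval_fps) (simp add: harm_fps_radius)
    moreover have "?z ^ n = of_real ((-1) ^ n * (?x\<^sup>2 / 4) ^ n)" for n
      unfolding x2 by (metis mult_minus_left of_real_minus of_real_mult of_real_power power_minus)
    ultimately show ?thesis by (simp add: harm_fps_def mult_ac)
  qed
  then have sm: "summable (\<lambda>n. (-1) ^ (n + 1) * harm n / (fact n)\<^sup>2 * (?x\<^sup>2 / 4) ^ n)"
    using sums_summable summable_of_real_iff by blast
  define T where "T = (\<Sum>n. (-1) ^ (n + 1) * harm n / (fact n)\<^sup>2 * (?x\<^sup>2 / 4) ^ n)"
  have T: "of_real T = eval_fps harm_fps ?z"
    unfolding T_def suminf_of_real[OF sm] by (rule sums_unique[OF S, symmetric])
  have Y: "of_real (bessel_Y0 ?x) = of_real (2 / pi) * (of_real (ln (?x / 2) + euler_mascheroni) * clifford 0 ?z + eval_fps harm_fps ?z)"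
    unfolding bessel_Y0_def T_def[symmetric] J[symmetric] T[symmetric] by (simp add: algebra_simps)
  show ?thesis
    unfolding hankel1_0_def Complex_eq hankel_sq_def L by (simp add: J Y mult.assoc)
qed

definition hankel_sq' :: "real \<Rightarrow> complex \<Rightarrow> complex" where
  "hankel_sq' k s = (let \<kappa> = of_real (k\<^sup>2 / 4); z = - \<kappa> * s in
     - \<kappa> * clifford 1 z + \<i> * of_real (2 / pi) *
     (clifford 0 z / (2 * s) - \<kappa> * (Ln s / 2 + of_real (ln (k / 2) + euler_mascheroni)) * clifford 1 z
       - \<kappa> * eval_fps (fps_deriv harm_fps) z))"

lemma hankel_sq_deriv:
  assumes "s \<notin> \<real>\<^sub>\<le>\<^sub>0"
  shows "(hankel_sq k has_field_derivative hankel_sq' k s) (at s)"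
proof -
  have "s \<noteq> 0" using assms by auto
  then show ?thesis
    using assms unfolding hankel_sq_def hankel_sq'_def Let_def
    by (auto intro!: derivative_eq_intros DERIV_chain2[OF has_field_derivative_eval_fps]
         simp: harm_fps_radius field_simps)
qed

text \<open>
  Bessel's equation of order zero in the variable \<open>s\<close>.
\<close>

lemma hankel_sq_ode:
  assumes s: "s \<notin> \<real>\<^sub>\<le>\<^sub>0"
  shows "s * deriv (hankel_sq' k) s + hankel_sq' k s + of_real (k\<^sup>2 / 4) * hankel_sq k s = 0"
proof -
  have nz: "s \<noteq> 0" using s by auto
  define \<kappa> :: complex where "\<kappa> = of_real (k\<^sup>2 / 4)"
  define c :: complex where "c = of_real (ln (k / 2) + euler_mascheroni)"
  define q :: complex where "q = \<i> * of_real (2 / pi)"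
  define z where "z = - \<kappa> * s"
  let ?b0 = "clifford 0 z" and ?b1 = "clifford 1 z" and ?b2 = "clifford 2 z"
  let ?E = "eval_fps harm_fps z" and ?E1 = "eval_fps (fps_deriv harm_fps) z" and ?E2 = "eval_fps (fps_deriv (fps_deriv harm_fps)) z"
  define H2 where "H2 = \<kappa>\<^sup>2 * ?b2 + q * (- ?b0 / (2 * s\<^sup>2) - \<kappa> * ?b1 / s + \<kappa>\<^sup>2 * (Ln s / 2 + c) * ?b2 + \<kappa>\<^sup>2 * ?E2)"
  have D: "(hankel_sq' k has_field_derivative H2) (at s)"
    using nz s
    unfolding hankel_sq'_def Let_def \<kappa>_def[symmetric] c_def[symmetric] q_def[symmetric] H2_def z_def
    by (auto intro!: derivative_eq_intros DERIV_chain2[OF has_field_derivative_eval_fps]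
       simp: harm_fps_deriv_radius numeral_2_eq_2 field_simps)
  have 1: "z * ?b2 + ?b1 = ?b0" using clifford_recurrence[of z 0] by (simp add: numeral_2_eq_2)
  have 2: "z * ?E2 + ?E1 = ?E - ?b1" by (rule harm_fps_ode)
  have "s * H2 + hankel_sq' k s + \<kappa> * hankel_sq k s
      = - \<kappa> * (z * ?b2 + ?b1 - ?b0) * (1 + q * (Ln s / 2 + c)) - \<kappa> * q * (z * ?E2 + ?E1 - ?E + ?b1)"
    using nz
    unfolding hankel_sq_def hankel_sq'_def Let_def \<kappa>_def[symmetric] c_def[symmetric] q_def[symmetric] H2_def z_def[symmetric]
    unfolding z_def by (simp add: field_simps power2_eq_square)
  also have "\<dots> = 0" using 1 2 by simp
  finally show ?thesis
    unfolding DERIV_imp_deriv[OF D] \<kappa>_def[symmetric] .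
qed

lemma holomorphic_hankel_sq: "hankel_sq k holomorphic_on - \<real>\<^sub>\<le>\<^sub>0"
  using hankel_sq_deriv by (intro holomorphic_onI) (auto simp: field_differentiable_def intro: has_field_derivative_at_within)

text \<open>
  Each instance is the derivative of the one before. The derivatives of \<open>H\<close> at a single point thus
  form a sequence that satisfies a three-term recurrence, and from here on only that sequence is
  studied.
\<close>

lemma higher_deriv_ode_recurrence:
  fixes H :: "complex \<Rightarrow> complex"
  assumes D: "open D" "H holomorphic_on D"
    and ode: "\<And>s. s \<in> D \<Longrightarrow> s * (deriv ^^ 2) H s + deriv H s + \<kappa> * H s = 0"
    and s: "s \<in> D"
  shows "s * (deriv ^^ (n + 2)) H s + of_nat (n + 1) * (deriv ^^ (n + 1)) H s + \<kappa> * (deriv ^^ n) H s = 0"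
  using s
proof (induction n arbitrary: s)
  case 0
  then show ?case using ode[of s] by (simp add: numeral_2_eq_2)
next
  case (Suc n)
  have d: "((deriv ^^ m) H has_field_derivative (deriv ^^ (m + 1)) H s) (at s)" for m
    using holomorphic_derivI[OF holomorphic_higher_deriv[OF D(2,1)] D(1) Suc.prems] by simp
  have "((\<lambda>s. s * (deriv ^^ (n + 2)) H s + of_nat (n + 1) * (deriv ^^ (n + 1)) H s + \<kappa> * (deriv ^^ n) H s)
     has_field_derivative
       s * (deriv ^^ (n + 2 + 1)) H s + (deriv ^^ (n + 2)) H s + of_nat (n + 1) * (deriv ^^ (n + 1 + 1)) H s
         + \<kappa> * (deriv ^^ (n + 1)) H s) (at s)"
    by (rule derivative_eq_intros refl d)+ simp
  moreover have "((\<lambda>s. s * (deriv ^^ (n + 2)) H s + of_nat (n + 1) * (deriv ^^ (n + 1)) H s + \<kappa> * (deriv ^^ n) H s)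
     has_field_derivative 0) (at s)"
    by (rule has_field_derivative_transform_within_open[OF DERIV_const[of 0] D(1) Suc.prems])
       (simp only: Suc.IH)
  ultimately have "s * (deriv ^^ (n + 2 + 1)) H s + (deriv ^^ (n + 2)) H s + of_nat (n + 1) * (deriv ^^ (n + 1 + 1)) H s
         + \<kappa> * (deriv ^^ (n + 1)) H s = 0" by (rule DERIV_unique)
  then show ?case by (simp add: algebra_simps numeral_2_eq_2)
qed

lemma hankel_sq_recurrence:
  assumes s: "s \<notin> \<real>\<^sub>\<le>\<^sub>0"
  shows "s * (deriv ^^ (n + 2)) (hankel_sq k) s + of_nat (n + 1) * (deriv ^^ (n + 1)) (hankel_sq k) s
     + of_real (k\<^sup>2 / 4) * (deriv ^^ n) (hankel_sq k) s = 0"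
proof (rule higher_deriv_ode_recurrence[OF _ holomorphic_hankel_sq])
  show op: "open (- \<real>\<^sub>\<le>\<^sub>0 :: complex set)" by auto
  show "s * (deriv ^^ 2) (hankel_sq k) s + deriv (hankel_sq k) s + of_real (k\<^sup>2 / 4) * hankel_sq k s = 0"
    if "s \<in> - \<real>\<^sub>\<le>\<^sub>0" for s
  proof -
    have d: "deriv (hankel_sq k) w = hankel_sq' k w" if "w \<notin> \<real>\<^sub>\<le>\<^sub>0" for w
      using hankel_sq_deriv[OF that] by (rule DERIV_imp_deriv)
    have "eventually (\<lambda>w. w \<in> - \<real>\<^sub>\<le>\<^sub>0) (nhds s)"
      using that op by (rule eventually_nhds_in_open[rotated])
    then have "eventually (\<lambda>w. deriv (hankel_sq k) w = hankel_sq' k w) (nhds s)"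
      by eventually_elim (simp add: d)
    then have "deriv (deriv (hankel_sq k)) s = deriv (hankel_sq' k) s" by (rule deriv_cong_ev) simp
    then show ?thesis using hankel_sq_ode[of s k] that by (simp add: numeral_2_eq_2 d)
  qed
qed (use s in auto)

section \<open>Size of the derivatives of the Hankel function\<close>

text \<open>
  The Casoratian is the discrete analogue of the Wronskian. For this recurrence it changes by the
  constant factor \<open>\<kappa>/s\<close> in each step.
\<close>

lemma casoratian:
  fixes a b :: "nat \<Rightarrow> complex"
  assumes s: "s \<noteq> 0"
    and a: "\<And>n. s * a (n + 2) + of_nat (n + 1) * a (n + 1) + \<kappa> * a n = 0"
    and b: "\<And>n. s * b (n + 2) + of_nat (n + 1) * b (n + 1) + \<kappa> * b n = 0"
  shows "a n * b (n + 1) - a (n + 1) * b n = (\<kappa> / s) ^ n * (a 0 * b 1 - a 1 * b 0)"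
proof (induction n)
  case (Suc n)
  have a': "s * a (n + 2) = - (of_nat (n + 1) * a (n + 1) + \<kappa> * a n)"
    and b': "s * b (n + 2) = - (of_nat (n + 1) * b (n + 1) + \<kappa> * b n)"
    using a[of n] b[of n] unfolding eq_neg_iff_add_eq_0 by (simp_all only: add.assoc)
  have "s * (a (n + 1) * b (n + 2) - a (n + 2) * b (n + 1))
      = a (n + 1) * (s * b (n + 2)) - (s * a (n + 2)) * b (n + 1)" by (simp add: algebra_simps)
  also have "\<dots> = \<kappa> * (a n * b (n + 1) - a (n + 1) * b n)"
    unfolding a' b' by (simp add: algebra_simps)
  finally have "a (n + 1) * b (n + 2) - a (n + 2) * b (n + 1) = \<kappa> / s * (a n * b (n + 1) - a (n + 1) * b n)"
    using s by (simp add: field_simps)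
  then show ?case unfolding Suc by simp
qed simp

text \<open>
  The perturbation is summable, as \<open>1/((n+1)(n+2))\<close> telescopes. The bound that is carried through
  the induction is multiplied by \<open>exp (q/((n+1)(n+2)))\<close> in step \<open>n\<close>, in total by at most \<open>exp q\<close>.
\<close>

lemma bounded_of_perturbed_recurrence:
  fixes u :: "nat \<Rightarrow> real"
  assumes u: "\<And>n. u (n + 2) \<le> u (n + 1) + q * u n / (real (n + 1) * real (n + 2))" and q: "q \<ge> 0"
  shows "u n \<le> max 0 (max (u 0) (u 1)) * exp q"
proof -
  define M where "M = max 0 (max (u 0) (u 1))"
  define P where "P n = exp (q * (1 - 1 / real (n + 1)))" for n
  have M: "M \<ge> 0" by (simp add: M_def)
  have "u n \<le> M * P n \<and> u (n + 1) \<le> M * P n"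
  proof (induction n)
    case 0
    then show ?case by (auto simp: M_def P_def)
  next
    case (Suc n)
    have d: "1 / (real (n + 1) * real (n + 2)) = 1 / real (n + 1) - 1 / real (n + 2)"
      by (simp add: field_simps)
    have PP: "P (n + 1) = P n * exp (q / (real (n + 1) * real (n + 2)))"
    proof -
      have "q * (1 - 1 / real (n + 1 + 1)) = q * (1 - 1 / real (n + 1)) + q * (1 / (real (n + 1) * real (n + 2)))"
        unfolding d by (simp add: algebra_simps)
      then show ?thesis unfolding P_def by (simp add: exp_add[symmetric])
    qed
    have pos: "q / (real (n + 1) * real (n + 2)) \<ge> 0" using q by simp
    have "P n \<le> P (n + 1)" unfolding PP using pos by (simp add: P_def)
    then have 1: "u (n + 1) \<le> M * P (n + 1)" using Suc M by (meson mult_left_mono order_trans)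
    have "u (n + 2) \<le> u (n + 1) + q / (real (n + 1) * real (n + 2)) * u n" using u[of n] by simp
    also have "\<dots> \<le> M * P n + q / (real (n + 1) * real (n + 2)) * (M * P n)"
      using Suc pos by (intro add_mono mult_left_mono) auto
    also have "\<dots> = M * P n * (1 + q / (real (n + 1) * real (n + 2)))" by (simp add: algebra_simps)
    also have "\<dots> \<le> M * P n * exp (q / (real (n + 1) * real (n + 2)))"
      using M by (intro mult_left_mono exp_ge_add_one_self) (auto simp: P_def)
    also have "\<dots> = M * P (n + 1)" unfolding PP by simp
    finally show ?case using 1 by (simp add: numeral_2_eq_2)
  qed
  moreover have "P n \<le> exp q"
    using q mult_left_mono[of "1 - 1 / real (n + 1)" 1 q] by (simp add: P_def)
  ultimately show ?thesis using M mult_left_mono[of "P n" "exp q" M] unfolding M_def[symmetric] by linarith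
qed

lemma positive_lower_bound:
  fixes u :: "nat \<Rightarrow> real"
  assumes "\<And>n. u n > 0" "d > 0" "eventually (\<lambda>n. u n \<ge> d) sequentially"
  shows "\<exists>c>0. \<forall>n. u n \<ge> c"
proof -
  obtain N where N: "\<And>n. n \<ge> N \<Longrightarrow> u n \<ge> d" using assms(3) by (auto simp: eventually_sequentially)
  define c where "c = Min (insert d (u ` {..<N}))"
  have "c > 0" unfolding c_def using assms(1,2) by (subst Min_gr_iff) auto
  moreover have "u n \<ge> c" for n
  proof (cases "n < N")
    case True
    then show ?thesis unfolding c_def by (intro Min_le) auto
  next
    case False
    have "c \<le> d" unfolding c_def by (intro Min_le) auto
    with N[of n] False show ?thesis by simp
  qed
  ultimately show ?thesis by blast
qed

text \<open>
  The Wronskian of \<open>J_0(k \<surd>s)\<close> with the Hankel function. It equals \<open>\<i>\<close> times the Wronskian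
  with \<open>Y_0(k \<surd>s)\<close>, because the contribution of the real part cancels.
\<close>

lemma hankel_sq_cross_product:
  assumes "s > 0"
  shows "clifford 0 (- of_real (k\<^sup>2 / 4) * of_real s) * hankel_sq' k (of_real s)
     - (- of_real (k\<^sup>2 / 4) * clifford 1 (- of_real (k\<^sup>2 / 4) * of_real s)) * hankel_sq k (of_real s)
     = \<i> / of_real (pi * s)"
proof -
  define \<kappa> :: complex where "\<kappa> = of_real (k\<^sup>2 / 4)"
  define c :: complex where "c = of_real (ln (k / 2) + euler_mascheroni)"
  define z where "z = - \<kappa> * of_real s"
  let ?s = "complex_of_real s"
  let ?b0 = "clifford 0 z" and ?b1 = "clifford 1 z"
  let ?E = "eval_fps harm_fps z" and ?E1 = "eval_fps (fps_deriv harm_fps) z"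
  have nz: "?s \<noteq> 0" using assms by simp
  have "(?b0 * hankel_sq' k ?s - (- \<kappa> * ?b1) * hankel_sq k ?s) * ?s
      = \<i> * of_real (2 / pi) * (?b0\<^sup>2 / 2 + z * (?b0 * ?E1 - ?b1 * ?E))"
    using nz
    unfolding hankel_sq_def hankel_sq'_def Let_def \<kappa>_def[symmetric] c_def[symmetric] z_def[symmetric]
    unfolding z_def by (simp add: field_simps power2_eq_square)
  also have "\<dots> = \<i> / of_real pi" unfolding wronskian_without_log by simp
  finally show ?thesis unfolding \<kappa>_def[symmetric] z_def[symmetric] using nz by (simp add: field_simps)
qed

text \<open>
  On the positive axis \<open>J_0\<close> and \<open>Y_0\<close> are the real and imaginary parts of the Hankel function, so
  this quantity is again their Wronskian. The form with a conjugate can be propagated by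
  \<open>casoratian\<close>, because the coefficients of the recurrence are real.
\<close>

lemma Im_cnj_hankel_sq:
  assumes "s > 0"
  shows "Im (cnj (hankel_sq k (of_real s)) * hankel_sq' k (of_real s)) = 1 / (pi * s)"
proof -
  define \<kappa> :: complex where "\<kappa> = of_real (k\<^sup>2 / 4)"
  define z where "z = - \<kappa> * of_real s"
  define L where "L = Ln (complex_of_real s) / 2 + of_real (ln (k / 2) + euler_mascheroni)"
  let ?s = "complex_of_real s"
  let ?b0 = "clifford 0 z" and ?b1 = "clifford 1 z"
  let ?E = "eval_fps harm_fps z" and ?E1 = "eval_fps (fps_deriv harm_fps) z"
  define j j' y y' where "j = ?b0" and "j' = - \<kappa> * ?b1"
    and "y = of_real (2 / pi) * (L * ?b0 + ?E)"
    and "y' = of_real (2 / pi) * (?b0 / (2 * ?s) - \<kappa> * L * ?b1 - \<kappa> * ?E1)"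
  have \<kappa>R: "\<kappa> \<in> \<real>" unfolding \<kappa>_def by (rule Reals_of_real)
  have zR: "z \<in> \<real>" unfolding z_def by (intro Reals_mult Reals_minus \<kappa>R Reals_of_real)
  have "L = of_real (ln s / 2 + (ln (k / 2) + euler_mascheroni))"
    using assms by (simp add: L_def Ln_of_real)
  then have LR: "L \<in> \<real>" by (simp only: Reals_of_real)
  have nth: "fps_nth (clifford_fps m) n \<in> \<real>" "fps_nth harm_fps n \<in> \<real>" "fps_nth (fps_deriv harm_fps) n \<in> \<real>" for m n
    by (simp_all add: clifford_fps_def harm_fps_def complex_is_Real_iff)
  have R: "?b0 \<in> \<real>" "?b1 \<in> \<real>" "?E \<in> \<real>" "?E1 \<in> \<real>"
    unfolding clifford_def
    by (rule Reals_eval_fps[OF clifford_fps_radius nth(1) zR] Reals_eval_fps[OF harm_fps_radius nth(2) zR]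
        Reals_eval_fps[OF harm_fps_deriv_radius(1) nth(3) zR])+
  have jy: "j \<in> \<real>" "j' \<in> \<real>" "y \<in> \<real>" "y' \<in> \<real>"
    unfolding j_def j'_def y_def y'_def
    by (intro Reals_mult Reals_add Reals_diff Reals_minus Reals_divide Reals_of_real Reals_numeral \<kappa>R LR R)+
  have h: "hankel_sq k ?s = j + \<i> * y" "hankel_sq' k ?s = j' + \<i> * y'"
    unfolding hankel_sq_def hankel_sq'_def Let_def \<kappa>_def[symmetric] z_def[symmetric] L_def[symmetric] j_def j'_def y_def y'_def
    by (simp_all add: mult.assoc)
  have "j * hankel_sq' k ?s - j' * hankel_sq k ?s = \<i> / of_real (pi * s)"
    using hankel_sq_cross_product[OF assms, of k] unfolding \<kappa>_def[symmetric] z_def[symmetric] j_def j'_def .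
  then have "Im (j * hankel_sq' k ?s - j' * hankel_sq k ?s) = Im (\<i> / of_real (pi * s))" by simp
  then have "Re j * Re y' - Re j' * Re y = 1 / (pi * s)"
    using jy unfolding h by (simp add: complex_is_Real_iff)
  then show ?thesis using jy unfolding h by (simp add: complex_is_Real_iff mult.commute)
qed

text \<open>
  If the \<open>n\<close>-th derivative vanished, so would the \<open>n\<close>-th Casoratian of the sequence of derivatives
  with its own conjugate. That Casoratian is a nonzero multiple of its initial value, which is
  \<open>2 \<i> / (\<pi> s)\<close>.
\<close>

lemma higher_deriv_hankel_sq_nonzero:
  assumes "k > 0" "s > 0"
  shows "(deriv ^^ n) (hankel_sq k) (of_real s) \<noteq> 0"
proof
  assume z: "(deriv ^^ n) (hankel_sq k) (of_real s) = 0"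
  define a where "a n = (deriv ^^ n) (hankel_sq k) (of_real s)" for n
  let ?\<kappa> = "complex_of_real (k\<^sup>2 / 4)"
  have s: "complex_of_real s \<notin> \<real>\<^sub>\<le>\<^sub>0" using assms by (simp add: complex_nonpos_Reals_iff)
  have a: "of_real s * a (n + 2) + of_nat (n + 1) * a (n + 1) + ?\<kappa> * a n = 0" for n
    unfolding a_def by (rule hankel_sq_recurrence[OF s])
  have ca: "of_real s * cnj (a (n + 2)) + of_nat (n + 1) * cnj (a (n + 1)) + ?\<kappa> * cnj (a n) = 0" for n
    using arg_cong[OF a[of n], of cnj] by simp
  have a1: "a 1 = hankel_sq' k (of_real s)" unfolding a_def using DERIV_imp_deriv[OF hankel_sq_deriv[OF s]] by simp
  have "cnj (a n) * a (n + 1) - cnj (a (n + 1)) * a n = (?\<kappa> / of_real s) ^ n * (cnj (a 0) * a 1 - cnj (a 1) * a 0)"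
    by (rule casoratian[OF _ ca a]) (use assms in auto)
  moreover have "a n = 0" using z by (simp add: a_def)
  ultimately have "cnj (a 0) * a 1 - cnj (a 1) * a 0 = 0" using assms by simp
  then have "Im (cnj (a 0) * a 1 - cnj (a 1) * a 0) = 0" by simp
  then have "Im (cnj (a 0) * a 1) = 0" by (simp add: algebra_simps)
  then show False using Im_cnj_hankel_sq[OF assms(2), of k] assms unfolding a1 by (simp add: a_def)
qed

text \<open>
  The \<open>n\<close>-th derivative has exactly the size of that of the logarithm, about \<open>(n-1)! / s\<^sup>n\<close>. After
  rescaling by this factor, the recurrence bounds the absolute values by
  \<open>u\<^sub>n\<^sub>+\<^sub>2 \<le> u\<^sub>n\<^sub>+\<^sub>1 + O(u\<^sub>n / n\<^sup>2)\<close>, so that \<open>u\<close> is bounded. The derivatives \<open>b n\<close> of \<open>J_0(k \<surd>s)\<close>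
  satisfy the same recurrence but are only of size \<open>\<kappa>\<^sup>n / n!\<close>, whereas the Casoratian of the two
  sequences has size \<open>(\<kappa>/s)\<^sup>n\<close>; this forces \<open>u\<close> to stay away from zero from
  some index on, and the finitely many earlier values are nonzero.
\<close>

lemma higher_deriv_hankel_sq_bounds:
  assumes k: "k > 0" and s: "s > 0"
  shows "\<exists>c>0. \<exists>C. \<forall>n. c \<le> norm ((deriv ^^ n) (hankel_sq k) (of_real s)) * s ^ n * (real n + 1) / fact n \<and>
           norm ((deriv ^^ n) (hankel_sq k) (of_real s)) * s ^ n * (real n + 1) / fact n \<le> C"
proof -
  define a where "a n = (deriv ^^ n) (hankel_sq k) (of_real s)" for n
  define \<kappa> where "\<kappa> = k\<^sup>2 / 4"
  have \<kappa>: "\<kappa> > 0" using k by (simp add: \<kappa>_def)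
  have s': "complex_of_real s \<notin> \<real>\<^sub>\<le>\<^sub>0" using s by (simp add: complex_nonpos_Reals_iff)
  have a: "of_real s * a (n + 2) + of_nat (n + 1) * a (n + 1) + of_real \<kappa> * a n = 0" for n
    unfolding a_def \<kappa>_def by (rule hankel_sq_recurrence[OF s'])
  have a0: "a n \<noteq> 0" for n unfolding a_def by (rule higher_deriv_hankel_sq_nonzero[OF k s])
  define u where "u n = norm (a (n + 1)) * s ^ (n + 1) / fact n" for n
  have u0: "u n > 0" for n using a0[of "n + 1"] s by (simp add: u_def)
  have step: "u (n + 2) \<le> u (n + 1) + (\<kappa> * s) * u n / (real (n + 1) * real (n + 2))" for n
  proof -
    have "of_real s * a (n + 3) = - (of_nat (n + 2) * a (n + 2) + of_real \<kappa> * a (n + 1))"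
      using a[of "n + 1"] unfolding eq_neg_iff_add_eq_0 by (simp add: numeral_3_eq_3 numeral_2_eq_2 add.assoc)
    then have "norm (of_real s * a (n + 3)) \<le> norm (of_nat (n + 2) * a (n + 2)) + norm (of_real \<kappa> * a (n + 1))"
      by (metis norm_minus_cancel norm_triangle_ineq)
    then have "s * norm (a (n + 3)) \<le> real (n + 2) * norm (a (n + 2)) + \<kappa> * norm (a (n + 1))"
      using s \<kappa> by (simp add: norm_mult del: of_nat_add of_nat_Suc)
    then have "(s * norm (a (n + 3))) * (s ^ (n + 2) / fact (n + 2))
        \<le> (real (n + 2) * norm (a (n + 2)) + \<kappa> * norm (a (n + 1))) * (s ^ (n + 2) / fact (n + 2))"
      using s by (intro mult_right_mono) auto
    moreover have f: "fact (n + 2) = (real n + 2) * ((real n + 1) * fact n)" "fact (n + 1) = (real n + 1) * (fact n :: real)"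
      by (simp_all add: numeral_2_eq_2 algebra_simps)
    moreover have "(s * norm (a (n + 3))) * (s ^ (n + 2) / fact (n + 2)) = u (n + 2)"
      by (simp add: u_def numeral_3_eq_3 numeral_2_eq_2)
    moreover have "(real (n + 2) * norm (a (n + 2)) + \<kappa> * norm (a (n + 1))) * (s ^ (n + 2) / fact (n + 2))
        = u (n + 1) + (\<kappa> * s) * u n / (real (n + 1) * real (n + 2))"
    proof -
      have alg: "((x + 2) * A + \<kappa> * B) * (P * s / ((x + 2) * ((x + 1) * F)))
          = A * (P * s) / ((x + 1) * F) + \<kappa> * s * (B * P / F) / ((x + 1) * (x + 2))"
        if "x \<ge> 0" "F > 0" for x A B P F :: real
      proof -
        have "x + 1 \<noteq> 0" "x + 2 \<noteq> 0" "F \<noteq> 0" using that by auto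
        then show ?thesis by (simp add: divide_simps) (simp add: algebra_simps)
      qed
      have "s ^ (n + 2) = s ^ (n + 1) * s" "u (n + 1) = norm (a (n + 2)) * s ^ (n + 2) / fact (n + 1)"
        by (simp_all add: u_def numeral_2_eq_2)
      moreover have "u n = norm (a (n + 1)) * s ^ (n + 1) / fact n" by (rule u_def)
      moreover have "real (n + 2) = real n + 2" "real (n + 1) = real n + 1" by simp_all
      ultimately show ?thesis using alg[of "real n" "fact n"] unfolding f by (simp only: fact_gt_zero of_nat_0_le_iff simp_thms)
    qed
    ultimately show ?thesis by (simp only:)
  qed
  define M where "M = max 0 (max (u 0) (u 1)) * exp (\<kappa> * s)"
  have uM: "u n \<le> M" for n
    unfolding M_def by (rule bounded_of_perturbed_recurrence[OF step]) (use \<kappa> s in auto)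
  \<comment> \<open>the derivatives of \<open>J_0(k \<surd>s)\<close>, a rapidly decaying solution of the same recurrence\<close>
  define b where "b n = (- complex_of_real \<kappa>) ^ n * clifford n (- of_real \<kappa> * of_real s)" for n
  have b: "of_real s * b (n + 2) + of_nat (n + 1) * b (n + 1) + of_real \<kappa> * b n = 0" for n
  proof -
    let ?z = "- of_real \<kappa> * complex_of_real s"
    have "of_real s * b (n + 2) + of_nat (n + 1) * b (n + 1) + of_real \<kappa> * b n
      = (- complex_of_real \<kappa>) ^ (n + 1) * (?z * clifford (n + 2) ?z + of_nat (n + 1) * clifford (n + 1) ?z - clifford n ?z)"
    proof -
      have p: "(- complex_of_real \<kappa>) ^ (n + 1) = - of_real \<kappa> * (- of_real \<kappa>) ^ n"
        "(- complex_of_real \<kappa>) ^ (n + 2) = of_real \<kappa> * of_real \<kappa> * (- of_real \<kappa>) ^ n"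
        by simp_all
      have alg: "S * (\<kappa>' * \<kappa>' * P * A) + q * (- \<kappa>' * P * B) + \<kappa>' * (P * D) = - \<kappa>' * P * (- \<kappa>' * S * A + q * B - D)"
        for S \<kappa>' P A B D q :: complex by (simp add: algebra_simps)
      show ?thesis unfolding b_def p by (rule alg)
    qed
    then show ?thesis unfolding clifford_recurrence by simp
  qed
  define K where "K = exp (\<kappa> * s)"
  have bK: "norm (b n) \<le> \<kappa> ^ n * K / fact n" for n
  proof -
    have "norm (b n) = \<kappa> ^ n * norm (clifford n (- of_real \<kappa> * of_real s))"
      using \<kappa> by (simp add: b_def norm_mult norm_power)
    also have "\<dots> \<le> \<kappa> ^ n * (exp (norm (- of_real \<kappa> * complex_of_real s)) / fact n)"
      using \<kappa> by (intro mult_left_mono norm_clifford_le) auto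
    finally show ?thesis using \<kappa> s by (simp add: K_def norm_mult)
  qed
  have "b n * a (n + 1) - b (n + 1) * a n = (of_real \<kappa> / of_real s) ^ n * (\<i> / of_real (pi * s))" for n
  proof -
    have "a 1 = hankel_sq' k (of_real s)" unfolding a_def using DERIV_imp_deriv[OF hankel_sq_deriv[OF s']] by simp
    then have "b 0 * a 1 - b 1 * a 0 = \<i> / of_real (pi * s)"
      using hankel_sq_cross_product[OF s, of k] by (simp add: b_def \<kappa>_def a_def)
    then show ?thesis using casoratian[OF _ b a, of n] s by simp
  qed
  then have W: "norm (b n * a (n + 1) - b (n + 1) * a n) = (\<kappa> / s) ^ n / (pi * s)" for n
    using \<kappa> s by (simp add: norm_mult norm_divide norm_power)
  \<comment> \<open>the estimate of the Casoratian, rescaled to \<open>u\<close>; its second summand tends to zero\<close>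
  have low: "1 / (pi * K) \<le> u (n + 1) + \<kappa> * s * M / ((real n + 1) * (real n + 2))" for n
  proof -
    let ?n = "n + 1"
    have "(\<kappa> / s) ^ ?n / (pi * s) \<le> norm (b ?n * a (?n + 1)) + norm (b (?n + 1) * a ?n)"
      unfolding W[of ?n, symmetric] by (rule norm_triangle_ineq4)
    also have "\<dots> \<le> \<kappa> ^ ?n * K / fact ?n * norm (a (?n + 1)) + \<kappa> ^ (?n + 1) * K / fact (?n + 1) * norm (a ?n)"
      unfolding norm_mult by (intro add_mono mult_right_mono bK) auto
    finally have "((\<kappa> / s) ^ ?n / (pi * s)) * (s ^ (?n + 1) / (\<kappa> ^ ?n * K))
       \<le> (\<kappa> ^ ?n * K / fact ?n * norm (a (?n + 1)) + \<kappa> ^ (?n + 1) * K / fact (?n + 1) * norm (a ?n)) * (s ^ (?n + 1) / (\<kappa> ^ ?n * K))"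
      using s \<kappa> by (intro mult_right_mono) (auto simp: K_def)
    moreover have "((\<kappa> / s) ^ ?n / (pi * s)) * (s ^ (?n + 1) / (\<kappa> ^ ?n * K)) = 1 / (pi * K)"
      using s \<kappa> by (simp add: K_def field_simps)
    moreover have "(\<kappa> ^ ?n * K / fact ?n * norm (a (?n + 1)) + \<kappa> ^ (?n + 1) * K / fact (?n + 1) * norm (a ?n)) * (s ^ (?n + 1) / (\<kappa> ^ ?n * K))
       = u ?n + \<kappa> * s * u n / ((real n + 1) * (real n + 2))"
    proof -
      have K: "K > 0" by (simp add: K_def)
      have f: "fact (n + 1 + 1) = (real n + 2) * (real n + 1) * fact n" "fact (n + 1) = (real n + 1) * (fact n :: real)"
        by (simp_all add: algebra_simps)
      have alg: "(Q * K / ((x + 1) * F) * A + \<kappa> * Q * K / ((x + 2) * (x + 1) * F) * B) * (s * P / (Q * K))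
          = A * (s * P) / ((x + 1) * F) + \<kappa> * s * (B * P / F) / ((x + 1) * (x + 2))"
        if "x \<ge> 0" "F > 0" "Q > 0" for x A B P F Q :: real
      proof -
        have "x + 1 \<noteq> 0" "x + 2 \<noteq> 0" "F \<noteq> 0" "Q \<noteq> 0" "K \<noteq> 0" using that K by auto
        then show ?thesis by (simp add: divide_simps) (simp add: algebra_simps)
      qed
      have "\<kappa> ^ (n + 1) > 0" using \<kappa> by simp
      moreover have e: "\<kappa> ^ (n + 1 + 1) = \<kappa> * \<kappa> ^ (n + 1)" "s ^ (n + 1 + 1) = s * s ^ (n + 1)" by simp_all
      ultimately show ?thesis
        unfolding u_def f e by (intro alg) auto
    qed
    moreover have "\<kappa> * s * u n / ((real n + 1) * (real n + 2)) \<le> \<kappa> * s * M / ((real n + 1) * (real n + 2))"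
      using s \<kappa> uM[of n] by (intro divide_right_mono mult_left_mono) auto
    ultimately show ?thesis by linarith
  qed
  have K: "K > 0" by (simp add: K_def)
  have M0: "\<kappa> * s * M \<ge> 0" using \<kappa> s by (simp add: M_def)
  have "(\<lambda>n. \<kappa> * s * M / real n) \<longlonglongrightarrow> 0" by (rule lim_const_over_n)
  then have "eventually (\<lambda>n. \<kappa> * s * M / real n < 1 / (2 * pi * K)) sequentially"
    using K by (intro order_tendstoD) auto
  then have "eventually (\<lambda>n. \<kappa> * s * M / ((real n + 1) * (real n + 2)) < 1 / (2 * pi * K)) sequentially"
    using eventually_gt_at_top[of 0]
  proof eventually_elim
    case (elim n)
    have "real n * 1 \<le> (real n + 1) * (real n + 2)" by (intro mult_mono) auto
    then have "\<kappa> * s * M / ((real n + 1) * (real n + 2)) \<le> \<kappa> * s * M / real n"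
      using M0 elim(2) by (intro divide_left_mono) auto
    with elim(1) show ?case by linarith
  qed
  then have "eventually (\<lambda>n. 1 / (2 * pi * K) \<le> u (n + 1)) sequentially"
  proof eventually_elim
    case (elim n)
    define e where "e = 1 / (2 * pi * K)"
    have "1 / (pi * K) = 2 * e" using K by (simp add: e_def)
    with low[of n] elim show ?case unfolding e_def[symmetric] by linarith
  qed
  then have "eventually (\<lambda>n. 1 / (2 * pi * K) \<le> u n) sequentially"
    by (rule eventually_sequentially_Suc[THEN iffD1, unfolded Suc_eq_plus1])
  then obtain c where c: "c > 0" "\<And>n. u n \<ge> c"
    using positive_lower_bound[of u "1 / (2 * pi * K)", OF u0] K by auto
  let ?w = "\<lambda>n. norm (a n) * s ^ n * (real n + 1) / fact n"
  have w: "?w (Suc n) = u n * ((real n + 2) / (real n + 1))" for n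
  proof -
    have "real n + 1 > 0" by simp
    then show ?thesis by (simp add: u_def field_simps)
  qed
  have r: "1 \<le> (real n + 2) / (real n + 1)" "(real n + 2) / (real n + 1) \<le> 2" for n
    by (simp_all add: field_simps)
  have "min c (norm (a 0)) \<le> ?w n \<and> ?w n \<le> max (2 * M) (norm (a 0))" for n
  proof (cases n)
    case (Suc m)
    have "c * 1 \<le> u m * ((real m + 2) / (real m + 1))"
      using c(2)[of m] r(1)[of m] c(1) by (intro mult_mono) auto
    moreover have "u m * ((real m + 2) / (real m + 1)) \<le> M * 2"
      using uM[of m] r(2)[of m] u0[of m] by (intro mult_mono) auto
    ultimately show ?thesis unfolding Suc w by linarith
  qed simp
  moreover have "min c (norm (a 0)) > 0" using c a0 by simp
  ultimately show ?thesis unfolding a_def by blast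
qed

section \<open>The addition theorem\<close>

text \<open>
  The arguments lie strictly between \<open>-\<pi>/2\<close> and \<open>\<pi>/2\<close>, so that of the product is not \<open>\<pi>\<close>. The
  product \<open>(R - p)(R - q)\<close> therefore stays off the cut for all \<open>\<bar>p\<bar>, \<bar>q\<bar> < R\<close>.
\<close>

lemma mult_notin_nonpos_Reals:
  assumes "Re a > 0" "Re b > 0"
  shows "a * b \<notin> \<real>\<^sub>\<le>\<^sub>0"
proof
  assume "a * b \<in> \<real>\<^sub>\<le>\<^sub>0"
  then have 1: "Re a * Re b \<le> Im a * Im b" and 2: "Re a * Im b = - (Im a * Re b)"
    by (auto simp: complex_nonpos_Reals_iff)
  have "Re a * (Re a * Re b) \<le> Re a * (Im a * Im b)" using 1 assms by (intro mult_left_mono) auto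
  also have "\<dots> = Im a * (Re a * Im b)" by simp
  also have "\<dots> = - ((Im a)\<^sup>2 * Re b)" unfolding 2 by (simp add: power2_eq_square)
  also have "\<dots> \<le> 0" using assms by simp
  finally show False using assms by (simp add: mult_le_0_iff zero_less_mult_iff not_le)
qed

lemma summable_on_int_geometric:
  fixes r :: real
  assumes "0 \<le> r" "r < 1"
  shows "(\<lambda>l::int. r ^ nat \<bar>l\<bar>) summable_on UNIV"
proof -
  have n: "(\<lambda>n. r ^ n) summable_on UNIV"
    using assms by (intro norm_summable_imp_summable_on) (simp add: norm_power)
  have "(\<lambda>l::int. r ^ nat \<bar>l\<bar>) summable_on (range int)"
    using n by (subst summable_on_reindex) (auto simp: o_def)
  moreover have "(\<lambda>l::int. r ^ nat \<bar>l\<bar>) summable_on (range (\<lambda>n. - int n))"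
    using n by (subst summable_on_reindex) (auto simp: o_def inj_on_def)
  ultimately have "(\<lambda>l::int. r ^ nat \<bar>l\<bar>) summable_on (range int \<union> range (\<lambda>n. - int n))"
    by (rule summable_on_union)
  moreover have "range int \<union> range (\<lambda>n. - int n) = UNIV"
  proof (rule UNIV_eq_I[symmetric])
    fix l :: int
    show "l \<in> range int \<union> range (\<lambda>n. - int n)" by (cases l rule: int_cases2) auto
  qed
  ultimately show ?thesis by simp
qed

lemma has_sum_if_sums:
  fixes f :: "nat \<Rightarrow> complex"
  assumes "f summable_on UNIV" "f sums S"
  shows "(f has_sum S) UNIV"
proof -
  obtain X where X: "(f has_sum X) UNIV" using assms(1) by (auto simp: summable_on_def)
  have "X = S" by (rule sums_unique2[OF has_sum_imp_sums[OF X] assms(2)])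
  with X show ?thesis by simp
qed

text \<open>
  Taylor coefficients of \<open>H((R - p)(R - q))\<close>: \<open>inner_coeff H R n p\<close> is the coefficient of \<open>q\<^sup>n\<close> for
  fixed \<open>p\<close>, and \<open>double_coeff H R n m\<close> that of \<open>p\<^sup>m q\<^sup>n\<close>. Expanding in one variable at a time keeps
  the argument within the theory of holomorphic functions of one variable. The coefficients on the
  axes \<open>n = 0\<close> and \<open>m = 0\<close> are the \<open>leading_coeff\<close>s.
\<close>

definition inner_coeff :: "(complex \<Rightarrow> complex) \<Rightarrow> real \<Rightarrow> nat \<Rightarrow> complex \<Rightarrow> complex" where
  "inner_coeff H R n p = (p - of_real R) ^ n * (deriv ^^ n) H (of_real R * (of_real R - p)) / fact n"

definition double_coeff :: "(complex \<Rightarrow> complex) \<Rightarrow> real \<Rightarrow> nat \<Rightarrow> nat \<Rightarrow> complex" where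
  "double_coeff H R n m = (deriv ^^ m) (inner_coeff H R n) 0 / fact m"

definition leading_coeff :: "(complex \<Rightarrow> complex) \<Rightarrow> real \<Rightarrow> nat \<Rightarrow> complex" where
  "leading_coeff H R l = (- of_real R) ^ l * (deriv ^^ l) H (of_real R ^ 2) / fact l"

context
  fixes H :: "complex \<Rightarrow> complex" and \<kappa> :: complex and R :: real
  assumes holo: "H holomorphic_on - \<real>\<^sub>\<le>\<^sub>0"
    and rec: "\<And>s n. s \<notin> \<real>\<^sub>\<le>\<^sub>0 \<Longrightarrow> s * (deriv ^^ (n + 2)) H s + of_nat (n + 1) * (deriv ^^ (n + 1)) H s + \<kappa> * (deriv ^^ n) H s = 0"
    and R: "R > 0"
begin

lemma Re_pos_ball: "p \<in> ball 0 R \<Longrightarrow> Re (of_real R - p) > 0"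
  using complex_Re_le_cmod[of p] by simp

lemma open_slit: "open (- \<real>\<^sub>\<le>\<^sub>0 :: complex set)" by auto

lemma inner_point_slit: "p \<in> ball 0 R \<Longrightarrow> complex_of_real R * (of_real R - p) \<notin> \<real>\<^sub>\<le>\<^sub>0"
  using mult_notin_nonpos_Reals[of "of_real R" "of_real R - p"] Re_pos_ball R by simp

lemma inner_coeff_sums:
  assumes p: "p \<in> ball 0 R" and q: "q \<in> ball 0 R"
  shows "(\<lambda>n. inner_coeff H R n p * q ^ n) sums H ((of_real R - p) * (of_real R - q))"
proof -
  define u c where "u = p - of_real R" and "c = of_real R * (of_real R - p)"
  have uc: "u * q + c = (of_real R - p) * (of_real R - q)" for q by (simp add: u_def c_def algebra_simps)
  have in_slit: "u * w + c \<in> - \<real>\<^sub>\<le>\<^sub>0" if "w \<in> ball 0 R" for w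
    unfolding uc using mult_notin_nonpos_Reals[OF Re_pos_ball[OF p] Re_pos_ball[OF that]] by simp
  have "(\<lambda>q. H (u * q + c)) holomorphic_on ball 0 R"
    by (rule holomorphic_on_compose_gen[OF _ holo, unfolded o_def]) (use in_slit in \<open>auto intro!: holomorphic_intros\<close>)
  from holomorphic_power_series[OF this q]
  have "(\<lambda>n. (deriv ^^ n) (\<lambda>q. H (u * q + c)) 0 / fact n * q ^ n) sums H (u * q + c)" by simp
  moreover have "(deriv ^^ n) (\<lambda>q. H (u * q + c)) 0 / fact n = inner_coeff H R n p" for n
    using higher_deriv_compose_linear'[where z=0, OF holo open_ball[of 0 R] open_slit _ in_slit] R
    by (simp add: inner_coeff_def u_def c_def)
  ultimately show ?thesis by (simp only: uc)
qed

text \<open>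
  This is the equation \<open>\<partial>\<^sub>p \<partial>\<^sub>q F = - \<kappa> F\<close> for \<open>F(p, q) = H((R - p)(R - q))\<close>, that is, the Helmholtz
  equation in complex coordinates, read off at the coefficients of \<open>q\<^sup>n\<close>.
\<close>

lemma inner_coeff_deriv:
  assumes p: "p \<in> ball 0 R"
  shows "(inner_coeff H R (Suc n) has_field_derivative (- \<kappa> / of_nat (Suc n)) * inner_coeff H R n p) (at p)"
proof -
  define s where "s = of_real R * (of_real R - p)"
  define h where "h n = (deriv ^^ n) H" for n
  have s: "s \<in> - \<real>\<^sub>\<le>\<^sub>0" unfolding s_def using inner_point_slit[OF p] by simp
  have "(h (n + 1) has_field_derivative h (n + 2) s) (at s)"
    using holomorphic_derivI[OF holomorphic_higher_deriv[OF holo open_slit] open_slit s, of "n + 1"] by (simp add: h_def)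
  then have hd: "((\<lambda>p. h (n + 1) (of_real R * (of_real R - p))) has_field_derivative h (n + 2) s * - of_real R) (at p)"
    unfolding s_def by (rule DERIV_chain2) (auto intro!: derivative_eq_intros)
  have hr: "s * h (n + 2) s + of_nat (n + 1) * h (n + 1) s = - \<kappa> * h n s"
    using rec[of s n] s unfolding h_def by (simp add: eq_neg_iff_add_eq_0)
  have "((\<lambda>p. (p - of_real R) ^ Suc n * h (n + 1) (of_real R * (of_real R - p)) / fact (Suc n)) has_field_derivative
       (of_nat (Suc n) * (p - of_real R) ^ n * h (n + 1) s + (p - of_real R) ^ Suc n * (h (n + 2) s * - of_real R)) / fact (Suc n)) (at p)"
    by (rule derivative_eq_intros hd refl)+ (simp_all add: s_def del: of_nat_Suc)
  moreover have "(of_nat (Suc n) * (p - of_real R) ^ n * h (n + 1) s + (p - of_real R) ^ Suc n * (h (n + 2) s * - of_real R))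
     = (p - of_real R) ^ n * (s * h (n + 2) s + of_nat (n + 1) * h (n + 1) s)"
    by (simp add: s_def algebra_simps)
  moreover have "(p - of_real R) ^ n * (- \<kappa> * h n s) / fact (Suc n) = (- \<kappa> / of_nat (Suc n)) * inner_coeff H R n p"
    by (simp add: inner_coeff_def h_def s_def)
  moreover have "inner_coeff H R (Suc n) = (\<lambda>p. (p - of_real R) ^ Suc n * h (n + 1) (of_real R * (of_real R - p)) / fact (Suc n))"
    by (simp add: inner_coeff_def[abs_def] h_def)
  ultimately show ?thesis by (simp only: hr)
qed

lemma holomorphic_inner_coeff: "inner_coeff H R n holomorphic_on ball 0 R"
proof -
  have "(\<lambda>p. (deriv ^^ n) H (of_real R * (of_real R - p))) holomorphic_on ball 0 R"
    using inner_point_slit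
    by (intro holomorphic_on_compose_gen[OF _ holomorphic_higher_deriv[OF holo open_slit], unfolded o_def])
       (auto intro!: holomorphic_intros)
  then show ?thesis unfolding inner_coeff_def[abs_def] by (intro holomorphic_intros) auto
qed

lemma double_coeff_sums:
  "p \<in> ball 0 R \<Longrightarrow> (\<lambda>m. double_coeff H R n m * p ^ m) sums inner_coeff H R n p"
  using holomorphic_power_series[OF holomorphic_inner_coeff] by (simp add: double_coeff_def)

lemma double_coeff_left_0: "double_coeff H R n 0 = (- of_real R) ^ n * (deriv ^^ n) H (of_real R ^ 2) / fact n"
  by (simp add: double_coeff_def inner_coeff_def power2_eq_square)

lemma double_coeff_right_0: "double_coeff H R 0 m = (- of_real R) ^ m * (deriv ^^ m) H (of_real R ^ 2) / fact m"
proof -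
  have "inner_coeff H R 0 = (\<lambda>p. H (- of_real R * p + of_real R ^ 2))"
    by (simp add: inner_coeff_def[abs_def] algebra_simps power2_eq_square)
  moreover have "(deriv ^^ m) (\<lambda>p. H (- of_real R * p + of_real R ^ 2)) 0 = (- of_real R) ^ m * (deriv ^^ m) H (- of_real R * 0 + of_real R ^ 2)"
  proof (rule higher_deriv_compose_linear'[OF holo open_ball[of 0 R] open_slit])
    fix p :: complex assume "p \<in> ball 0 R"
    from inner_point_slit[OF this] show "- of_real R * p + of_real R ^ 2 \<in> - \<real>\<^sub>\<le>\<^sub>0" by (simp add: algebra_simps power2_eq_square)
  qed (use R in auto)
  ultimately show ?thesis by (simp add: double_coeff_def)
qed

lemma double_coeff_Suc_Suc:
  "double_coeff H R (Suc n) (Suc m) = - \<kappa> / (of_nat (Suc n) * of_nat (Suc m)) * double_coeff H R n m"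
proof -
  have "(deriv ^^ Suc m) (inner_coeff H R (Suc n)) 0 = (deriv ^^ m) (deriv (inner_coeff H R (Suc n))) 0"
    by (simp add: funpow_Suc_right del: funpow.simps)
  also have "\<dots> = (deriv ^^ m) (\<lambda>p. (- \<kappa> / of_nat (Suc n)) * inner_coeff H R n p) 0"
  proof (rule higher_deriv_transform_within_open[where S = "ball 0 R"])
    show "(\<lambda>p. (- \<kappa> / of_nat (Suc n)) * inner_coeff H R n p) holomorphic_on ball 0 R"
      by (intro holomorphic_intros holomorphic_inner_coeff)
    show "deriv (inner_coeff H R (Suc n)) holomorphic_on ball 0 R"
      by (intro holomorphic_deriv holomorphic_inner_coeff open_ball)
    fix p :: complex assume "p \<in> ball 0 R"
    then show "deriv (inner_coeff H R (Suc n)) p = (- \<kappa> / of_nat (Suc n)) * inner_coeff H R n p"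
      by (intro DERIV_imp_deriv inner_coeff_deriv)
  qed (use R in auto)
  also have "\<dots> = (- \<kappa> / of_nat (Suc n)) * (deriv ^^ m) (inner_coeff H R n) 0"
    using R by (intro higher_deriv_cmult[OF holomorphic_inner_coeff]) auto
  finally show ?thesis by (simp add: double_coeff_def)
qed

lemma double_coeff_diag:
  "double_coeff H R (j + n) (j + m) = (- \<kappa>) ^ j * (fact n * fact m) / (fact (j + n) * fact (j + m)) * double_coeff H R n m"
proof (induction j)
  case (Suc j)
  show ?case
    unfolding add_Suc double_coeff_Suc_Suc Suc fact_Suc power_Suc by (simp add: mult_ac del: of_nat_Suc)
qed simp

text \<open>
  Coefficients of \<open>p\<^sup>m q\<^sup>n\<close> indexed by the frequency \<open>l = m - n\<close>, to which they contribute on the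
  circle \<open>q = cnj p\<close>, and by \<open>j = min m n\<close>. For fixed \<open>l\<close> the dependence on \<open>j\<close> is that of the terms
  of \<open>clifford \<bar>l\<bar> (- \<kappa>)\<close>.
\<close>

lemma double_coeff_int:
  "double_coeff H R (j + nat (- l)) (j + nat l)
     = (- \<kappa>) ^ j / (fact j * fact (j + nat \<bar>l\<bar>)) * (fact (nat \<bar>l\<bar>) * leading_coeff H R (nat \<bar>l\<bar>))"
proof (cases "l \<ge> 0")
  case True
  then show ?thesis
    using double_coeff_diag[of j 0 "nat l"] by (simp add: double_coeff_right_0 leading_coeff_def)
next
  case False
  then show ?thesis
    using double_coeff_diag[of j "nat (-l)" 0] by (simp add: double_coeff_left_0 leading_coeff_def mult.commute)
qed

text \<open>
  Graf's addition theorem. On the circle \<open>cnj z = 1/z\<close>, so the double Taylor series becomes a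
  series in powers \<open>z\<^sup>m\<^sup>-\<^sup>n\<close>; summing it first over all pairs with the same difference gives the Bessel
  factor. The decay of the leading coefficients makes the double series absolutely convergent
  and so justifies the rearrangement.
\<close>

lemma addition_theorem:
  assumes z: "norm z = 1" and R1: "R > 1"
    and lead: "\<And>l. norm (leading_coeff H R l) \<le> C / R ^ l"
  shows "((\<lambda>l. fact (nat \<bar>l\<bar>) * leading_coeff H R (nat \<bar>l\<bar>) * clifford (nat \<bar>l\<bar>) (- \<kappa>) * z powi l)
           has_sum H ((of_real R - z) * (of_real R - cnj z))) UNIV"
proof -
  define T where "T = (\<lambda>(l, j). (- \<kappa>) ^ j / (fact j * fact (j + nat \<bar>l\<bar>)) * (fact (nat \<bar>l\<bar>) * leading_coeff H R (nat \<bar>l\<bar>)) * z powi l)"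
  define h where "h = (\<lambda>(n, m). double_coeff H R n m * z ^ m * cnj z ^ n)"
  define \<iota> :: "int \<times> nat \<Rightarrow> nat \<times> nat" where "\<iota> = (\<lambda>(l, j). (j + nat (- l), j + nat l))"
  have zz: "z * cnj z = 1" using z by (simp add: complex_norm_square[symmetric])
  have bij: "bij_betw \<iota> UNIV UNIV"
    by (rule bij_betwI[where g = "\<lambda>(n, m). (int m - int n, min n m)"]) (auto simp: \<iota>_def min_def)
  have powz: "z ^ (j + nat l) * cnj z ^ (j + nat (- l)) = z powi l" for l j
  proof -
    have "z ^ (j + nat l) * cnj z ^ (j + nat (- l)) = (z * cnj z) ^ j * (z ^ nat l * cnj z ^ nat (- l))"
      by (simp add: power_add power_mult_distrib)
    also have "\<dots> = z ^ nat l * inverse z ^ nat (- l)" using zz inverse_unique[OF zz] by simp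
    finally show ?thesis by (simp add: power_int_def)
  qed
  have hT: "h (\<iota> x) = T x" for x
  proof (cases x)
    case (Pair l j)
    show ?thesis unfolding Pair h_def T_def \<iota>_def prod.case double_coeff_int mult.assoc[of _ "z ^ _"] powz ..
  qed
  have C: "C \<ge> 0" using order_trans[OF norm_ge_zero lead[of 0]] by simp
  have Tb: "norm (T (l, j)) \<le> C * (1 / R) ^ nat \<bar>l\<bar> * (norm \<kappa> ^ j / fact j)" for l j
  proof -
    have "fact (nat \<bar>l\<bar>) \<le> (fact (j + nat \<bar>l\<bar>) :: real)" by (intro fact_mono) simp
    then have "fact (nat \<bar>l\<bar>) / fact (j + nat \<bar>l\<bar>) \<le> (1 :: real)" by (simp add: divide_le_eq_1)
    then have "norm \<kappa> ^ j / fact j * (fact (nat \<bar>l\<bar>) / fact (j + nat \<bar>l\<bar>)) * norm (leading_coeff H R (nat \<bar>l\<bar>))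
        \<le> norm \<kappa> ^ j / fact j * 1 * (C / R ^ nat \<bar>l\<bar>)"
      by (intro mult_mono mult_left_mono lead) auto
    moreover have "norm (T (l, j)) = norm \<kappa> ^ j / fact j * (fact (nat \<bar>l\<bar>) / fact (j + nat \<bar>l\<bar>)) * norm (leading_coeff H R (nat \<bar>l\<bar>))"
      using z by (simp add: T_def norm_mult norm_divide norm_power norm_power_int)
    ultimately show ?thesis by (simp add: power_divide mult.commute)
  qed
  have exps: "(\<lambda>j. norm \<kappa> ^ j / fact j) summable_on UNIV"
    using summable_exp[of "norm \<kappa>"] by (intro norm_summable_imp_summable_on) (simp add: divide_inverse mult.commute)
  have "(\<lambda>x. norm (T x)) summable_on UNIV \<times> UNIV"
  proof (rule Infinite_Sum.abs_summable_on_comparison_test'[where g = "\<lambda>(l, j). C * (1 / R) ^ nat \<bar>l\<bar> * (norm \<kappa> ^ j / fact j)"])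
    have geo: "(\<lambda>l. C * (1 / R) ^ nat \<bar>l\<bar>) summable_on UNIV"
      by (intro summable_on_cmult_right summable_on_int_geometric) (use R1 in auto)
    show "(\<lambda>(l, j). C * (1 / R) ^ nat \<bar>l\<bar> * (norm \<kappa> ^ j / fact j)) summable_on UNIV \<times> UNIV"
    proof (rule summable_on_SigmaI)
      fix l :: int
      show "((\<lambda>j. case (l, j) of (l, j) \<Rightarrow> C * (1 / R) ^ nat \<bar>l\<bar> * (norm \<kappa> ^ j / fact j)) has_sum
        C * (1 / R) ^ nat \<bar>l\<bar> * infsum (\<lambda>j. norm \<kappa> ^ j / fact j) UNIV) UNIV"
        unfolding prod.case by (intro has_sum_cmult_right has_sum_infsum exps)
    next
      show "(\<lambda>l. C * (1 / R) ^ nat \<bar>l\<bar> * infsum (\<lambda>j. norm \<kappa> ^ j / fact j) UNIV) summable_on UNIV"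
        by (rule summable_on_cmult_left[OF geo])
    qed (use C R in auto)
  qed (use Tb in auto)
  then have "T summable_on UNIV \<times> UNIV" by (rule Infinite_Sum.abs_summable_summable)
  then obtain X where X: "(T has_sum X) (UNIV \<times> UNIV)" by (auto simp: summable_on_def)
  have hX: "(h has_sum X) (UNIV \<times> UNIV)"
    using X has_sum_reindex_bij_betw[OF bij, of h X] by (simp add: hT)
  have zb: "z \<in> ball 0 R" "cnj z \<in> ball 0 R" using z R1 by auto
  have "((\<lambda>n. inner_coeff H R n z * cnj z ^ n) has_sum X) UNIV"
  proof (rule has_sum_SigmaD[OF hX])
    fix n :: nat
    have "(\<lambda>m. h (n, m)) summable_on UNIV"
      using summable_on_SigmaD1[of "\<lambda>n m. h (n, m)" UNIV "\<lambda>_. UNIV" n] has_sum_imp_summable[OF hX] by simp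
    moreover have "(\<lambda>m. h (n, m)) sums (inner_coeff H R n z * cnj z ^ n)"
      unfolding h_def prod.case by (intro sums_mult2 double_coeff_sums zb)
    ultimately show "((\<lambda>m. h (n, m)) has_sum (inner_coeff H R n z * cnj z ^ n)) UNIV"
      by (rule has_sum_if_sums)
  qed
  then have "(\<lambda>n. inner_coeff H R n z * cnj z ^ n) sums X" by (rule has_sum_imp_sums)
  then have "X = H ((of_real R - z) * (of_real R - cnj z))"
    using inner_coeff_sums[OF zb] by (rule sums_unique2)
  moreover have "((\<lambda>l. fact (nat \<bar>l\<bar>) * leading_coeff H R (nat \<bar>l\<bar>) * clifford (nat \<bar>l\<bar>) (- \<kappa>) * z powi l) has_sum X) UNIV"
  proof (rule has_sum_SigmaD[OF X])
    fix l :: int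
    have "(\<lambda>j. T (l, j)) summable_on UNIV"
      using summable_on_SigmaD1[of "\<lambda>l j. T (l, j)" UNIV "\<lambda>_. UNIV" l] has_sum_imp_summable[OF X] by simp
    moreover have "(\<lambda>j. T (l, j)) sums (clifford (nat \<bar>l\<bar>) (- \<kappa>) * (fact (nat \<bar>l\<bar>) * leading_coeff H R (nat \<bar>l\<bar>)) * z powi l)"
      unfolding T_def prod.case by (intro sums_mult2 clifford_sums)
    ultimately have "((\<lambda>j. T (l, j)) has_sum (clifford (nat \<bar>l\<bar>) (- \<kappa>) * (fact (nat \<bar>l\<bar>) * leading_coeff H R (nat \<bar>l\<bar>)) * z powi l)) UNIV"
      by (rule has_sum_if_sums)
    then show "((\<lambda>j. T (l, j)) has_sum (fact (nat \<bar>l\<bar>) * leading_coeff H R (nat \<bar>l\<bar>) * clifford (nat \<bar>l\<bar>) (- \<kappa>) * z powi l)) UNIV"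
      by (simp add: mult_ac)
  qed
  ultimately show ?thesis by simp
qed

end

text \<open>
  The normalised values tend to one, so they are bounded away from zero once none of them vanishes.
\<close>

lemma clifford_bounds:
  assumes nz: "\<And>m. clifford m x \<noteq> 0"
  shows "\<exists>c>0. \<exists>C. \<forall>m. c \<le> norm (fact m * clifford m x) \<and> norm (fact m * clifford m x) \<le> C"
proof -
  have pos: "norm (fact m * clifford m x) > 0" for m using nz by simp
  have "(\<lambda>m. exp (norm x) / real (Suc m)) \<longlonglongrightarrow> 0"
    using LIMSEQ_Suc[OF lim_const_over_n[of "exp (norm x)"]] .
  then have "eventually (\<lambda>m. exp (norm x) / real (Suc m) < 1 / 2) sequentially" by (rule order_tendstoD) simp
  then have "eventually (\<lambda>m. 1 / 2 \<le> norm (fact m * clifford m x)) sequentially"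
  proof eventually_elim
    case (elim m)
    have "exp (norm x) / (real m + 1) < 1 / 2" using elim by (simp only: of_nat_Suc add.commute)
    then have "norm (fact m * clifford m x - 1) \<le> 1 / 2"
      using norm_fact_clifford_minus_1_le[of m x] by linarith
    then show ?case using norm_triangle_ineq2[of 1 "1 - fact m * clifford m x"] by (simp add: norm_minus_commute)
  qed
  then obtain c where c: "c > 0" "\<And>m. c \<le> norm (fact m * clifford m x)"
    using positive_lower_bound[of "\<lambda>m. norm (fact m * clifford m x)" "1 / 2", OF pos] by auto
  have "norm (fact m * clifford m x) \<le> exp (norm x)" for m
    using mult_left_mono[OF norm_clifford_le[of m x], of "fact m"] by (simp add: norm_mult)
  with c show ?thesis by blast
qed

text \<open>
  That \<open>k\<^sup>2\<close> is not a Dirichlet eigenvalue enters here: it makes the factor \<open>clifford \<bar>l\<bar> (- k\<^sup>2/4)\<close>,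
  which is \<open>J_l(k)\<close> up to a power, nonzero. The polynomial factor \<open>\<bar>l\<bar> + 1\<close> has to be the same in
  both bounds, because the estimate of the aliased terms uses quotients of two coefficients.
\<close>

lemma hankel_kernel_fourier_expansion:
  assumes k: "k > 0" and R: "R > 1" and nz: "\<And>m::int. bessel_J m k \<noteq> 0"
  shows "\<exists>(g :: int \<Rightarrow> complex) c C. c > 0 \<and>
    (\<forall>l. c \<le> norm (g l) * R ^ nat \<bar>l\<bar> * (real (nat \<bar>l\<bar>) + 1)) \<and>
    (\<forall>l. norm (g l) * R ^ nat \<bar>l\<bar> * (real (nat \<bar>l\<bar>) + 1) \<le> C) \<and>
    (\<forall>z. norm z = 1 \<longrightarrow>
       ((\<lambda>l. g l * z powi l) has_sum hankel_sq k ((of_real R - z) * (of_real R - cnj z))) UNIV)"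
proof -
  define \<kappa> where "\<kappa> = complex_of_real (k\<^sup>2 / 4)"
  define a where "a l = leading_coeff (hankel_sq k) R l" for l
  have pos: "R\<^sup>2 > 0" "R > 0" using R by auto
  have cl: "clifford m (- \<kappa>) \<noteq> 0" for m
    using bessel_J_clifford[OF k, of m] nz[of "int m"] by (auto simp: \<kappa>_def)
  obtain c1 C1 where 1: "c1 > 0" "\<And>m. c1 \<le> norm (fact m * clifford m (- \<kappa>))" "\<And>m. norm (fact m * clifford m (- \<kappa>)) \<le> C1"
    using clifford_bounds[of "- \<kappa>", OF cl] by blast
  obtain c2 C2 where 2: "c2 > 0"
    "\<And>n. c2 \<le> norm ((deriv ^^ n) (hankel_sq k) (of_real (R\<^sup>2))) * (R\<^sup>2) ^ n * (real n + 1) / fact n"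
    "\<And>n. norm ((deriv ^^ n) (hankel_sq k) (of_real (R\<^sup>2))) * (R\<^sup>2) ^ n * (real n + 1) / fact n \<le> C2"
    using higher_deriv_hankel_sq_bounds[OF k pos(1)] by blast
  have al: "norm (a n) * R ^ n * (real n + 1) = norm ((deriv ^^ n) (hankel_sq k) (of_real (R\<^sup>2))) * (R\<^sup>2) ^ n * (real n + 1) / fact n" for n
    using pos by (simp add: a_def leading_coeff_def norm_mult norm_divide norm_power power2_eq_square power_mult_distrib)
  define g where "g l = fact (nat \<bar>l\<bar>) * a (nat \<bar>l\<bar>) * clifford (nat \<bar>l\<bar>) (- \<kappa>)" for l :: int
  have gl: "norm (g l) * R ^ nat \<bar>l\<bar> * (real (nat \<bar>l\<bar>) + 1)
     = norm (fact (nat \<bar>l\<bar>) * clifford (nat \<bar>l\<bar>) (- \<kappa>)) * (norm (a (nat \<bar>l\<bar>)) * R ^ nat \<bar>l\<bar> * (real (nat \<bar>l\<bar>) + 1))" for l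
    by (simp add: g_def norm_mult)
  have C2: "C2 \<ge> 0" using 2(1) 2(2)[of 0] 2(3)[of 0] by linarith
  have lead: "norm (leading_coeff (hankel_sq k) R l) \<le> C2 / R ^ l" for l
  proof -
    have "norm (a l) * R ^ l * 1 \<le> norm (a l) * R ^ l * (real l + 1)" using pos by (intro mult_left_mono) auto
    also have "\<dots> \<le> C2" unfolding al by (rule 2)
    finally show ?thesis using pos by (simp add: a_def field_simps)
  qed
  show ?thesis
  proof (rule exI[of _ g], rule exI[of _ "c1 * c2"], rule exI[of _ "C1 * C2"], intro conjI allI impI)
    show "c1 * c2 > 0" using 1 2 by simp
    show "c1 * c2 \<le> norm (g l) * R ^ nat \<bar>l\<bar> * (real (nat \<bar>l\<bar>) + 1)" for l
      unfolding gl al using 1(1) 2(1) by (intro mult_mono[OF 1(2) 2(2)]) auto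
    show "norm (g l) * R ^ nat \<bar>l\<bar> * (real (nat \<bar>l\<bar>) + 1) \<le> C1 * C2" for l
      unfolding gl al using order_trans[OF norm_ge_zero 1(3)] pos
      by (intro mult_mono[OF 1(3) 2(3)]) auto
    show "((\<lambda>l. g l * z powi l) has_sum hankel_sq k ((of_real R - z) * (of_real R - cnj z))) UNIV" if "norm z = 1" for z
      unfolding g_def a_def
      by (rule addition_theorem[OF holomorphic_hankel_sq _ pos(2) that R lead, of \<kappa>])
         (use hankel_sq_recurrence in \<open>simp add: \<kappa>_def\<close>)
  qed
qed

section \<open>Equispaced charges and aliasing\<close>

lemma has_sum_sum_finite:
  fixes f :: "'a \<Rightarrow> 'b \<Rightarrow> complex"
  assumes "finite J" "\<And>j. j \<in> J \<Longrightarrow> (f j has_sum S j) A"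
  shows "((\<lambda>x. \<Sum>j\<in>J. f j x) has_sum (\<Sum>j\<in>J. S j)) A"
  using assms by (induction J rule: finite_induct) (auto intro!: has_sum_add)

lemma sum_roots_of_unity:
  assumes "N > 0"
  shows "(\<Sum>j=1..N. cis (of_int d * (2 * pi * real j / real N))) = (if int N dvd d then of_nat N else 0)"
proof -
  define w where "w = cis (of_int d * (2 * pi / real N))"
  have w: "cis (of_int d * (2 * pi * real j / real N)) = w ^ j" for j
    by (simp add: w_def Complex.DeMoivre mult_ac)
  have wN: "w ^ N = 1"
    using assms cis_multiple_2pi[of "of_int d"] by (simp add: w_def Complex.DeMoivre mult_ac)
  have w1: "w = 1 \<longleftrightarrow> int N dvd d"
  proof
    assume "w = 1"
    then have "cos (of_int d * (2 * pi / real N)) = 1" by (metis w_def cis.sel(1) one_complex.sel(1))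
    then obtain n :: int where "of_int d * (2 * pi / real N) = of_int n * 2 * pi" by (auto simp: cos_one_2pi_int)
    then have "real_of_int d = of_int (n * int N)" using assms by (simp add: field_simps)
    then have "d = n * int N" by (simp only: of_int_eq_iff)
    then show "int N dvd d" by simp
  next
    assume "int N dvd d"
    then obtain n where "d = int N * n" by blast
    then show "w = 1" using assms cis_multiple_2pi[of "of_int n"] by (simp add: w_def mult_ac)
  qed
  have "(\<Sum>j=1..N. w ^ j) = (\<Sum>j<N. w ^ Suc j)"
    by (rule sum.reindex_bij_witness[of _ Suc "\<lambda>j. j - 1"]) auto
  also have "\<dots> = w * (\<Sum>j<N. w ^ j)" by (simp add: sum_distrib_left)
  also have "\<dots> = (if w = 1 then of_nat N else 0)"
    using geometric_sum[of w N] wN by auto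
  finally show ?thesis unfolding w w1 .
qed

text \<open>
  There are \<open>N = 2 M\<close> charges, and their discrete Fourier transform only sees a frequency modulo
  \<open>2 M\<close>. Writing \<open>l = alias_freq M l + alias_shift M l * (2 M)\<close>, the first summand is the
  representative in the window.
\<close>

definition freq_window :: "nat \<Rightarrow> int set" where
  "freq_window M = {- int M..<int M}"

definition alias_freq :: "nat \<Rightarrow> int \<Rightarrow> int" where
  "alias_freq M l = (l + int M) mod (2 * int M) - int M"

definition alias_shift :: "nat \<Rightarrow> int \<Rightarrow> int" where
  "alias_shift M l = (l + int M) div (2 * int M)"

lemma alias_eq: "l = alias_freq M l + alias_shift M l * (2 * int M)"
  using div_mult_mod_eq[of "l + int M" "2 * int M"] by (simp add: alias_freq_def alias_shift_def)

lemma alias_in_window: "M > 0 \<Longrightarrow> alias_freq M l \<in> freq_window M"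
  using pos_mod_bound[of "2 * int M" "l + int M"] pos_mod_sign[of "2 * int M" "l + int M"]
  by (auto simp: alias_freq_def freq_window_def)

lemma window_shift_unique:
  assumes "m \<in> freq_window M"
  shows "alias_freq M (m + b * (2 * int M)) = m" "alias_shift M (m + b * (2 * int M)) = b"
proof -
  have b: "0 \<le> m + int M" "m + int M < 2 * int M" using assms by (auto simp: freq_window_def)
  have e: "m + b * (2 * int M) + int M = (m + int M) + b * (2 * int M)" by simp
  show "alias_freq M (m + b * (2 * int M)) = m"
    unfolding alias_freq_def e mod_mult_self1 using b by simp
  show "alias_shift M (m + b * (2 * int M)) = b"
    unfolding alias_shift_def e using b by (subst div_mult_self1) auto
qed

lemma bij_alias:
  assumes "M > 0"
  shows "bij_betw (\<lambda>l. (alias_freq M l, alias_shift M l)) UNIV (freq_window M \<times> UNIV)"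
  by (rule bij_betwI[where g = "\<lambda>(m, b). m + b * (2 * int M)"])
     (auto simp: alias_in_window[OF assms] window_shift_unique alias_eq[symmetric])

lemma alias_dvd_iff:
  assumes "M > 0" "m \<in> freq_window M"
  shows "int (2 * M) dvd m - l \<longleftrightarrow> m = alias_freq M l"
proof
  assume "int (2 * M) dvd m - l"
  then obtain t where "m - l = int (2 * M) * t" by blast
  then have "l = m + (- t) * (2 * int M)" by (simp add: algebra_simps)
  then show "m = alias_freq M l" using window_shift_unique(1)[OF assms(2)] by metis
next
  assume "m = alias_freq M l"
  then have "m - l = - (alias_shift M l * (2 * int M))" using alias_eq[of l M] by linarith
  then show "int (2 * M) dvd m - l" by simp
qed

lemma outside_window:
  assumes "M > 0" "l \<notin> freq_window M"
  shows "alias_shift M l \<noteq> 0" "\<bar>l\<bar> \<ge> int M" "\<bar>alias_freq M l\<bar> \<le> int M"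
    "\<bar>l\<bar> \<ge> \<bar>alias_shift M l\<bar> * (2 * int M) - \<bar>alias_freq M l\<bar>"
proof -
  show "alias_shift M l \<noteq> 0"
    using alias_eq[of l M] alias_in_window[OF assms(1), of l] assms(2) by (metis add.right_neutral mult_zero_left)
  show "\<bar>l\<bar> \<ge> int M" using assms by (auto simp: freq_window_def)
  show "\<bar>alias_freq M l\<bar> \<le> int M" using alias_in_window[OF assms(1), of l] by (auto simp: freq_window_def)
  have "\<bar>alias_shift M l\<bar> * (2 * int M) = \<bar>l - alias_freq M l\<bar>"
  proof -
    have "l - alias_freq M l = alias_shift M l * (2 * int M)" using alias_eq[of l M] by linarith
    then show ?thesis by (simp add: abs_mult)
  qed
  then show "\<bar>l\<bar> \<ge> \<bar>alias_shift M l\<bar> * (2 * int M) - \<bar>alias_freq M l\<bar>" by linarith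
qed

lemma sum_window_le:
  fixes f :: "nat \<Rightarrow> real"
  assumes "\<And>n. f n \<ge> 0"
  shows "(\<Sum>l\<in>freq_window M. f (nat \<bar>l\<bar>)) \<le> 2 * (\<Sum>n\<le>M. f n)"
proof -
  have split: "freq_window M = (\<lambda>n. - int n) ` {1..M} \<union> int ` {..<M}"
  proof
    show "freq_window M \<subseteq> (\<lambda>n. - int n) ` {1..M} \<union> int ` {..<M}"
    proof
      fix l assume l: "l \<in> freq_window M"
      show "l \<in> (\<lambda>n. - int n) ` {1..M} \<union> int ` {..<M}"
        using l by (cases l rule: int_cases2) (force simp: freq_window_def)+
    qed
  qed (auto simp: freq_window_def)
  have "(\<Sum>l\<in>freq_window M. f (nat \<bar>l\<bar>)) = (\<Sum>n=1..M. f n) + (\<Sum>n<M. f n)"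
    unfolding split
    by (subst sum.union_disjoint) (auto simp: sum.reindex inj_on_def)
  also have "\<dots> \<le> (\<Sum>n\<le>M. f n) + (\<Sum>n\<le>M. f n)"
    using assms by (intro add_mono sum_mono2) auto
  finally show ?thesis by simp
qed

lemma has_sum_geometric_tail:
  fixes x :: real
  assumes x: "0 < x" "x < 1" and M: "M > 0"
  shows "((\<lambda>l::int. if \<bar>l\<bar> \<ge> int M then x ^ nat \<bar>l\<bar> else 0) has_sum 2 * x ^ M / (1 - x)) UNIV"
proof -
  have "(\<lambda>i. x ^ M * x ^ i) sums (x ^ M * (1 / (1 - x)))" using x by (intro sums_mult geometric_sums) auto
  then have g: "((\<lambda>i. x ^ M * x ^ i) has_sum (x ^ M / (1 - x))) UNIV"
    using x by (intro norm_summable_imp_has_sum) (auto simp: norm_mult norm_power abs_of_pos intro!: summable_mult)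
  have p: "((\<lambda>l::int. x ^ nat \<bar>l\<bar>) has_sum (x ^ M / (1 - x))) (range (\<lambda>i. int (M + i)))"
    using g by (subst has_sum_reindex) (auto simp: inj_on_def o_def power_add nat_add_distrib mult.commute)
  have n: "((\<lambda>l::int. x ^ nat \<bar>l\<bar>) has_sum (x ^ M / (1 - x))) (range (\<lambda>i. - int (M + i)))"
    using g by (subst has_sum_reindex) (auto simp: inj_on_def o_def power_add nat_add_distrib mult.commute)
  have "((\<lambda>l::int. x ^ nat \<bar>l\<bar>) has_sum (x ^ M / (1 - x) + x ^ M / (1 - x)))
      (range (\<lambda>i. int (M + i)) \<union> range (\<lambda>i. - int (M + i)))"
    by (rule has_sum_Un_disjoint[OF p n]) (use M in auto)
  moreover have "range (\<lambda>i. int (M + i)) \<union> range (\<lambda>i. - int (M + i)) = {l. \<bar>l\<bar> \<ge> int M}"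
  proof (intro equalityI subsetI)
    fix l assume l: "l \<in> {l. \<bar>l\<bar> \<ge> int M}"
    show "l \<in> range (\<lambda>i. int (M + i)) \<union> range (\<lambda>i. - int (M + i))"
    proof (cases "l \<ge> 0")
      case True
      then have "l = int (M + nat (l - int M))" using l by auto
      then show ?thesis by blast
    next
      case False
      then have "l = - int (M + nat (- l - int M))" using l by auto
      then show ?thesis by blast
    qed
  qed auto
  ultimately have "((\<lambda>l::int. x ^ nat \<bar>l\<bar>) has_sum (2 * x ^ M / (1 - x))) {l. \<bar>l\<bar> \<ge> int M}"
    by (simp add: field_simps)
  then show ?thesis by (rule has_sum_cong_neutral[THEN iffD1, rotated -1]) auto
qed

text \<open>
  Frequencies correspond to pairs of a representative in the window and a shift, so a product
  majorant factors into a finite sum and a geometric series.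
\<close>

lemma has_sum_over_aliases:
  fixes q :: "int \<Rightarrow> real" and r :: real
  assumes M: "M > 0" and r: "0 \<le> r" "r < 1" and q: "\<And>m. q m \<ge> 0"
  shows "((\<lambda>l. q (alias_freq M l) * r ^ nat \<bar>alias_shift M l\<bar>) has_sum
      (\<Sum>m\<in>freq_window M. q m) * (\<Sum>\<^sub>\<infinity>b::int. r ^ nat \<bar>b\<bar>)) UNIV"
proof -
  define S where "S = (\<Sum>\<^sub>\<infinity>b::int. r ^ nat \<bar>b\<bar>)"
  define F where "F = (\<lambda>(m, b::int). q m * r ^ nat \<bar>b\<bar>)"
  have S: "((\<lambda>b::int. r ^ nat \<bar>b\<bar>) has_sum S) UNIV"
    unfolding S_def by (intro has_sum_infsum summable_on_int_geometric r)
  have inner: "((\<lambda>b. F (m, b)) has_sum q m * S) UNIV" for m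
    unfolding F_def prod.case by (intro has_sum_cmult_right S)
  have fin: "finite (freq_window M)" by (simp add: freq_window_def)
  have "(F has_sum (\<Sum>m\<in>freq_window M. q m * S)) (freq_window M \<times> UNIV)"
  proof (rule has_sum_SigmaI[OF inner])
    show "((\<lambda>m. q m * S) has_sum (\<Sum>m\<in>freq_window M. q m * S)) (freq_window M)"
      by (rule has_sum_finite[OF fin])
    show "F summable_on freq_window M \<times> UNIV"
      by (rule summable_on_SigmaI[OF inner]) (use fin q r in \<open>auto simp: F_def\<close>)
  qed
  then have "((\<lambda>l. F (alias_freq M l, alias_shift M l)) has_sum (\<Sum>m\<in>freq_window M. q m * S)) UNIV"
    by (subst has_sum_reindex_bij_betw[OF bij_alias[OF M]])
  then show ?thesis by (simp add: F_def S_def sum_distrib_right)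
qed

lemma fourier_coeff_decay:
  assumes rho: "\<rho> > 0"
    and asym: "(\<lambda>m. cmod (fourier_coeff v m)) \<sim>[filtercomap (abs :: int \<Rightarrow> int) at_top] (\<lambda>m. C0 * \<rho> powi (- \<bar>m\<bar>))"
  shows "\<exists>V\<ge>0. \<forall>m. cmod (fourier_coeff v m) \<le> V / \<rho> ^ nat \<bar>m\<bar>"
proof -
  have pw: "\<rho> powi (- \<bar>m\<bar>) = 1 / \<rho> ^ nat \<bar>m\<bar>" for m :: int
    by (simp add: power_int_def field_simps)
  obtain K where K: "K > 0" "eventually (\<lambda>m. norm (cmod (fourier_coeff v m)) \<le> K * norm (C0 * \<rho> powi (- \<bar>m\<bar>))) (filtercomap (abs :: int \<Rightarrow> int) at_top)"
    using asymp_equiv_imp_bigo[OF asym] by (rule landau_o.bigE)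
  then obtain L where L: "\<And>m. \<bar>m\<bar> \<ge> L \<Longrightarrow> cmod (fourier_coeff v m) \<le> K * norm (C0 * \<rho> powi (- \<bar>m\<bar>))"
    by (auto simp: eventually_filtercomap_at_top_linorder)
  define V where "V = K * \<bar>C0\<bar> + (\<Sum>m\<in>{-\<bar>L\<bar>..\<bar>L\<bar>}. cmod (fourier_coeff v m) * \<rho> ^ nat \<bar>m\<bar>)"
  have s0: "(\<Sum>m\<in>{-\<bar>L\<bar>..\<bar>L\<bar>}. cmod (fourier_coeff v m) * \<rho> ^ nat \<bar>m\<bar>) \<ge> 0" using rho by (intro sum_nonneg) auto
  have "V \<ge> 0" using K(1) s0 by (simp add: V_def)
  moreover have "cmod (fourier_coeff v m) \<le> V / \<rho> ^ nat \<bar>m\<bar>" for m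
  proof -
    have "cmod (fourier_coeff v m) * \<rho> ^ nat \<bar>m\<bar> \<le> V"
    proof (cases "\<bar>m\<bar> \<ge> L")
      case True
      have "cmod (fourier_coeff v m) \<le> K * \<bar>C0\<bar> / \<rho> ^ nat \<bar>m\<bar>"
        using L[OF True] rho unfolding pw by (simp add: abs_mult)
      then have "cmod (fourier_coeff v m) * \<rho> ^ nat \<bar>m\<bar> \<le> K * \<bar>C0\<bar>" using rho by (simp add: field_simps)
      then show ?thesis using s0 by (simp add: V_def)
    next
      case False
      have "cmod (fourier_coeff v m) * \<rho> ^ nat \<bar>m\<bar> \<le> (\<Sum>m\<in>{-\<bar>L\<bar>..\<bar>L\<bar>}. cmod (fourier_coeff v m) * \<rho> ^ nat \<bar>m\<bar>)"
        using False rho by (intro member_le_sum) auto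
      then show ?thesis using K(1) mult_nonneg_nonneg[of K "\<bar>C0\<bar>"] unfolding V_def by linarith
    qed
    then show ?thesis using rho by (simp add: field_simps)
  qed
  ultimately show ?thesis by blast
qed

text \<open>
  The inverse discrete Fourier transform of \<open>\<beta>\<close> restricted to the window of length \<open>N\<close>.
\<close>

definition mfs_coeff :: "(int \<Rightarrow> complex) \<Rightarrow> nat \<Rightarrow> nat \<Rightarrow> complex" where
  "mfs_coeff \<beta> N j = 1 / of_nat N * (\<Sum>m\<in>freq_window (N div 2). \<beta> m * cis (of_int m * (2 * pi * real j / real N)))"

lemma coeff_norm_mfs_coeff:
  assumes "N > 0"
  shows "coeff_norm N (mfs_coeff \<beta> N) \<le> (\<Sum>m\<in>freq_window (N div 2). cmod (\<beta> m))"
proof -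
  have "cmod (mfs_coeff \<beta> N j) \<le> 1 / real N * (\<Sum>m\<in>freq_window (N div 2). cmod (\<beta> m))" for j
  proof -
    have "cmod (\<Sum>m\<in>freq_window (N div 2). \<beta> m * cis (of_int m * (2 * pi * real j / real N)))
       \<le> (\<Sum>m\<in>freq_window (N div 2). cmod (\<beta> m))"
      by (rule order_trans[OF norm_sum]) (simp add: norm_mult)
    then show ?thesis by (simp add: mfs_coeff_def norm_mult norm_divide divide_right_mono)
  qed
  then have "(\<Sum>j=1..N. cmod (mfs_coeff \<beta> N j)) \<le> (\<Sum>j=1..N. 1 / real N * (\<Sum>m\<in>freq_window (N div 2). cmod (\<beta> m)))"
    by (intro sum_mono)
  also have "\<dots> = (\<Sum>m\<in>freq_window (N div 2). cmod (\<beta> m))" using assms by simp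
  finally have "(\<Sum>j=1..N. cmod (mfs_coeff \<beta> N j)) \<le> (\<Sum>m\<in>freq_window (N div 2). cmod (\<beta> m))" .
  moreover have "coeff_norm N (mfs_coeff \<beta> N) \<le> (\<Sum>j=1..N. cmod (mfs_coeff \<beta> N j))"
    unfolding coeff_norm_def by (rule L2_set_le_sum) simp
  ultimately show ?thesis by linarith
qed

lemma sum_mfs_coeff_cis:
  assumes "M > 0"
  shows "(\<Sum>j=1..2*M. mfs_coeff \<beta> (2 * M) j * cis (- (of_int l * (2 * pi * real j / real (2 * M))))) = \<beta> (alias_freq M l)"
proof -
  define \<phi> where "\<phi> j = 2 * pi * real j / real (2 * M)" for j
  have fin: "finite (freq_window M)" by (simp add: freq_window_def)
  have "(\<Sum>j=1..2*M. mfs_coeff \<beta> (2 * M) j * cis (- (of_int l * \<phi> j)))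
      = (\<Sum>j=1..2*M. \<Sum>m\<in>freq_window M. 1 / of_nat (2 * M) * \<beta> m * cis (of_int (m - l) * \<phi> j))"
  proof (rule sum.cong[OF refl])
    fix j
    have "cis (of_int m * \<phi> j) * cis (- (of_int l * \<phi> j)) = cis (of_int (m - l) * \<phi> j)" for m
      by (simp add: cis_mult algebra_simps)
    then show "mfs_coeff \<beta> (2 * M) j * cis (- (of_int l * \<phi> j))
      = (\<Sum>m\<in>freq_window M. 1 / of_nat (2 * M) * \<beta> m * cis (of_int (m - l) * \<phi> j))"
      unfolding mfs_coeff_def \<phi>_def[symmetric]
      by (simp add: sum_distrib_left sum_distrib_right mult.assoc del: of_nat_mult of_int_diff)
  qed
  also have "\<dots> = (\<Sum>m\<in>freq_window M. \<Sum>j=1..2*M. 1 / of_nat (2 * M) * \<beta> m * cis (of_int (m - l) * \<phi> j))"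
    by (rule sum.swap)
  also have "\<dots> = (\<Sum>m\<in>freq_window M. if m = alias_freq M l then \<beta> m else 0)"
  proof (rule sum.cong[OF refl])
    fix m assume m: "m \<in> freq_window M"
    have "(\<Sum>j=1..2*M. 1 / of_nat (2 * M) * \<beta> m * cis (of_int (m - l) * \<phi> j))
       = 1 / of_nat (2 * M) * \<beta> m * (if m = alias_freq M l then of_nat (2 * M) else 0)"
      using sum_roots_of_unity[of "2 * M" "m - l"] assms
      unfolding sum_distrib_left[symmetric] \<phi>_def alias_dvd_iff[OF assms m] by (simp only:)
    then show "(\<Sum>j=1..2*M. 1 / of_nat (2 * M) * \<beta> m * cis (of_int (m - l) * \<phi> j)) = (if m = alias_freq M l then \<beta> m else 0)"
      using assms by simp
  qed
  also have "\<dots> = \<beta> (alias_freq M l)" using alias_in_window[OF assms] fin by (simp add: sum.delta')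
  finally show ?thesis by (simp only: \<phi>_def)
qed

text \<open>
  Rotating by the angle of the \<open>j\<close>-th charge reduces its field to the kernel expansion with
  \<open>z = e\<^sup>i\<^sup>(\<^sup>\<theta>\<^sup>-\<^sup>\<phi>\<^sup>)\<close>. The frequency \<open>l\<close> picks up the factor \<open>e\<^sup>-\<^sup>i\<^sup>l\<^sup>\<phi>\<close>, and the sum over the charges is
  a discrete Fourier transform of the coefficients, which inverts \<open>mfs_coeff\<close> up to aliasing.
\<close>

lemma mfs_has_sum:
  fixes g :: "int \<Rightarrow> complex"
  assumes k: "k > 0" and R: "R > 1" and M: "M > 0"
    and g: "\<And>z. norm z = 1 \<Longrightarrow> ((\<lambda>l. g l * z powi l) has_sum hankel_sq k ((of_real R - z) * (of_real R - cnj z))) UNIV"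
  shows "((\<lambda>l. \<i> / 4 * g l * \<beta> (alias_freq M l) * cis (of_int l * \<theta>)) has_sum mfs k R (2 * M) (mfs_coeff \<beta> (2 * M)) (cis \<theta>)) UNIV"
proof -
  define \<phi> where "\<phi> j = 2 * pi * real j / real (2 * M)" for j
  let ?\<alpha> = "mfs_coeff \<beta> (2 * M)"
  have h: "((\<lambda>l. g l * cis (- (of_int l * \<phi> j)) * cis (of_int l * \<theta>)) has_sum
      hankel1_0 (k * cmod (cis \<theta> - charge_point R (2 * M) j))) UNIV" for j
  proof -
    define z where "z = cis (\<theta> - \<phi> j)"
    have z: "norm z = 1" by (simp add: z_def)
    have "cis \<theta> - charge_point R (2 * M) j = cis (\<phi> j) * (z - of_real R)"
      unfolding charge_point_def \<phi>_def[symmetric] by (simp add: z_def algebra_simps cis_mult)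
    then have "cmod (cis \<theta> - charge_point R (2 * M) j) = cmod (of_real R - z)"
      by (simp add: norm_mult norm_minus_commute)
    also have "\<dots> = sqrt ((cmod (of_real R - z))\<^sup>2)" by simp
    finally have "hankel1_0 (k * cmod (cis \<theta> - charge_point R (2 * M) j)) = hankel1_0 (k * sqrt ((cmod (of_real R - z))\<^sup>2))" by simp
    also have "\<dots> = hankel_sq k (of_real ((cmod (of_real R - z))\<^sup>2))"
    proof (rule hankel1_0_eq_hankel_sq[OF k])
      have "of_real R \<noteq> z" using z R by auto
      then show "(cmod (of_real R - z))\<^sup>2 > 0" by simp
    qed
    also have "of_real ((cmod (of_real R - z))\<^sup>2) = (of_real R - z) * (of_real R - cnj z)"
      unfolding complex_norm_square by simp
    finally have "((\<lambda>l. g l * z powi l) has_sum hankel1_0 (k * cmod (cis \<theta> - charge_point R (2 * M) j))) UNIV"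
      using g[OF z] by simp
    moreover have "g l * z powi l = g l * cis (- (of_int l * \<phi> j)) * cis (of_int l * \<theta>)" for l
      unfolding z_def cis_powi by (simp add: cis_mult algebra_simps)
    ultimately show ?thesis by simp
  qed
  have "((\<lambda>l. \<i> / 4 * (\<Sum>j=1..2*M. ?\<alpha> j * (g l * cis (- (of_int l * \<phi> j)) * cis (of_int l * \<theta>)))) has_sum
     mfs k R (2 * M) ?\<alpha> (cis \<theta>)) UNIV"
    unfolding mfs_def by (intro has_sum_cmult_right has_sum_sum_finite h finite_atLeastAtMost)
  moreover have "\<i> / 4 * (\<Sum>j=1..2*M. ?\<alpha> j * (g l * cis (- (of_int l * \<phi> j)) * cis (of_int l * \<theta>)))
     = \<i> / 4 * g l * \<beta> (alias_freq M l) * cis (of_int l * \<theta>)" for l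
  proof -
    have "(\<Sum>j=1..2*M. ?\<alpha> j * (g l * cis (- (of_int l * \<phi> j)) * cis (of_int l * \<theta>)))
       = g l * cis (of_int l * \<theta>) * (\<Sum>j=1..2*M. ?\<alpha> j * cis (- (of_int l * \<phi> j)))"
      unfolding sum_distrib_left by (rule sum.cong[OF refl]) (simp add: mult_ac)
    also have "(\<Sum>j=1..2*M. ?\<alpha> j * cis (- (of_int l * \<phi> j))) = \<beta> (alias_freq M l)"
      unfolding \<phi>_def by (rule sum_mfs_coeff_cis[OF M])
    finally have "(\<Sum>j=1..2*M. ?\<alpha> j * (g l * cis (- (of_int l * \<phi> j)) * cis (of_int l * \<theta>)))
       = g l * cis (of_int l * \<theta>) * \<beta> (alias_freq M l)" .
    then show ?thesis by (simp only: mult_ac)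
  qed
  ultimately show ?thesis by (simp only:)
qed

section \<open>Error bound and convergence rates\<close>

text \<open>
  The Fourier coefficients \<open>e l\<close> of the error vanish in the window. Outside, \<open>e l\<close> is the difference
  of the aliased term \<open>g l / g m * v_m\<close> with \<open>m = alias_freq M l\<close> and of the tail term \<open>v_l\<close>, where \<open>v_m\<close>
  are the Fourier coefficients of \<open>v\<close>. As \<open>\<bar>m\<bar> \<le> \<bar>l\<bar>\<close>, the polynomial factors of \<open>g l / g m\<close> can be
  dropped. With \<open>b = \<bar>alias_shift M l\<bar> \<ge> 1\<close> and \<open>\<bar>l\<bar> \<ge> 2 M b - \<bar>m\<bar>\<close>, the square of the aliased
  term is at most a constant times \<open>(R\<^sup>2/\<rho>)\<^sup>2\<^sup>\<bar>\<^sup>m\<^sup>\<bar> R\<^sup>-\<^sup>4\<^sup>M R\<^sup>-\<^sup>b\<close>, which is summed over all \<open>l\<close> by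
  \<open>has_sum_over_aliases\<close>.
\<close>

lemma boundary_error_sq_bound:
  fixes g :: "int \<Rightarrow> complex"
  assumes k: "k > 0" and R: "1 < R" "R < \<rho>" and v: "continuous_on (sphere 0 1) v"
    and c: "c > 0" "\<And>l. c \<le> norm (g l) * R ^ nat \<bar>l\<bar> * (real (nat \<bar>l\<bar>) + 1)"
    and C: "\<And>l. norm (g l) * R ^ nat \<bar>l\<bar> * (real (nat \<bar>l\<bar>) + 1) \<le> C"
    and g: "\<And>z. norm z = 1 \<Longrightarrow> ((\<lambda>l. g l * z powi l) has_sum hankel_sq k ((of_real R - z) * (of_real R - cnj z))) UNIV"
    and V: "V \<ge> 0" "\<And>m. cmod (fourier_coeff v m) \<le> V / \<rho> ^ nat \<bar>m\<bar>"
    and \<beta>: "\<And>m. \<beta> m = fourier_coeff v m / (\<i> / 4 * g m)"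
  shows "\<exists>K\<ge>0. \<forall>M>0. (boundary_error k R v (2 * M) (mfs_coeff \<beta> (2 * M)))\<^sup>2
     \<le> K * (1 / \<rho> ^ (2 * M) + 1 / R ^ (4 * M) * (\<Sum>m\<in>freq_window M. ((R\<^sup>2 / \<rho>)\<^sup>2) ^ nat \<bar>m\<bar>))"
proof -
  have pos: "R > 0" "\<rho> > 0" "\<rho> > 1" using R by auto
  have C0: "C \<ge> 0" using c(1) c(2)[of 0] C[of 0] by linarith
  have g0: "g l \<noteq> 0" for l using c(1) c(2)[of l] by auto
  have gup: "norm (g l) \<le> C / (R ^ nat \<bar>l\<bar> * (real (nat \<bar>l\<bar>) + 1))" for l
    using C[of l] pos by (simp add: pos_le_divide_eq mult.assoc del: of_nat_nat)
  have gup': "norm (g l) \<le> C * (1 / R) ^ nat \<bar>l\<bar>" for l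
  proof -
    have "C / (R ^ nat \<bar>l\<bar> * (real (nat \<bar>l\<bar>) + 1)) \<le> C / (R ^ nat \<bar>l\<bar> * 1)"
      using pos C0 by (intro divide_left_mono mult_left_mono mult_pos_pos) auto
    then show ?thesis using gup[of l] by (simp add: power_divide)
  qed
  have glow: "1 / norm (g l) \<le> R ^ nat \<bar>l\<bar> * (real (nat \<bar>l\<bar>) + 1) / c" for l
    using c(1) c(2)[of l] g0[of l] by (simp add: field_simps del: of_nat_nat)
  have vR: "cmod (fourier_coeff v m) \<le> V * (1 / R) ^ nat \<bar>m\<bar>" for m
  proof -
    have "V / \<rho> ^ nat \<bar>m\<bar> \<le> V / R ^ nat \<bar>m\<bar>" using pos R V by (intro divide_left_mono power_mono mult_pos_pos) auto
    then show ?thesis using V(2)[of m] by (simp add: power_divide)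
  qed
  have geo: "(\<lambda>l::int. (1 / R) ^ nat \<bar>l\<bar>) summable_on UNIV" using R by (intro summable_on_int_geometric) auto
  have vsum: "(\<lambda>m. norm (fourier_coeff v m)) summable_on UNIV"
    by (rule Infinite_Sum.abs_summable_on_comparison_test'[OF summable_on_cmult_right[OF geo] vR])
  define x where "x = 1 / \<rho>\<^sup>2"
  have x: "0 < x" "x < 1" using pos by (auto simp: x_def)
  define D where "D = C / c"
  define S where "S = (\<Sum>\<^sub>\<infinity>b::int. (1 / R) ^ nat \<bar>b\<bar>)"
  have S0: "S \<ge> 0" unfolding S_def using pos by (intro infsum_nonneg) auto
  define q where "q m = ((R\<^sup>2 / \<rho>)\<^sup>2) ^ nat \<bar>m\<bar>" for m :: int
  have q0: "q m \<ge> 0" for m by (simp add: q_def)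
  define K1 K2 where "K1 = 8 * pi * V\<^sup>2 / (1 - x)" and "K2 = 4 * pi * D\<^sup>2 * V\<^sup>2 * R * S"
  have K: "K1 \<ge> 0" "K2 \<ge> 0" using x pos S0 by (auto simp: K1_def K2_def)
  have main: "(boundary_error k R v (2 * M) (mfs_coeff \<beta> (2 * M)))\<^sup>2
     \<le> K1 / \<rho> ^ (2 * M) + K2 / R ^ (4 * M) * (\<Sum>m\<in>freq_window M. q m)" if M: "M > 0" for M
  proof -
    let ?w = "\<lambda>\<theta>. mfs k R (2 * M) (mfs_coeff \<beta> (2 * M)) (cis \<theta>) - v (cis \<theta>)"
    define e where "e l = \<i> / 4 * g l * \<beta> (alias_freq M l) - fourier_coeff v l" for l
    have fin: "finite (freq_window M)" by (simp add: freq_window_def)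
    define B where "B = (\<Sum>m\<in>freq_window M. norm (\<beta> m))"
    have B: "norm (\<beta> (alias_freq M l)) \<le> B" for l
      unfolding B_def using alias_in_window[OF M] fin by (intro member_le_sum) auto
    have "norm (e l) \<le> (C / 4 * B + V) * (1 / R) ^ nat \<bar>l\<bar>" for l
    proof -
      have "norm (e l) \<le> norm (\<i> / 4 * g l * \<beta> (alias_freq M l)) + norm (fourier_coeff v l)"
        unfolding e_def by (rule norm_triangle_ineq4)
      also have "norm (\<i> / 4 * g l * \<beta> (alias_freq M l)) = 1 / 4 * (norm (g l) * norm (\<beta> (alias_freq M l)))"
        by (simp add: norm_mult norm_divide)
      also have "\<dots> \<le> 1 / 4 * ((C * (1 / R) ^ nat \<bar>l\<bar>) * B)"
        using C0 pos by (intro mult_left_mono mult_mono gup' B) auto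
      finally show ?thesis using vR[of l] by (simp add: algebra_simps)
    qed
    then have esum: "(\<lambda>l. norm (e l)) summable_on UNIV"
      by (rule Infinite_Sum.abs_summable_on_comparison_test'[OF summable_on_cmult_right[OF geo]])
    have ehas: "((\<lambda>l. e l * cis (of_int l * \<theta>)) has_sum ?w \<theta>) UNIV" for \<theta>
    proof -
      have "((\<lambda>l. - (fourier_coeff v l * cis (of_int l * \<theta>))) has_sum - v (cis \<theta>)) UNIV"
        by (intro has_sum_uminusI fourier_series_has_sum v vsum)
      from has_sum_add[OF mfs_has_sum[OF k R(1) M g] this] show ?thesis
        by (simp add: e_def algebra_simps)
    qed
    have P: "((\<lambda>l. 2 * pi * (norm (e l))\<^sup>2) has_sum integral {0..2*pi} (\<lambda>\<theta>. (norm (?w \<theta>))\<^sup>2)) UNIV"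
      by (rule parseval_trig_series[OF esum ehas])
    have "integral {0..2*pi} (\<lambda>\<theta>. (norm (?w \<theta>))\<^sup>2) \<ge> 0" by (rule has_sum_nonneg[OF P]) simp
    then have err: "(boundary_error k R v (2 * M) (mfs_coeff \<beta> (2 * M)))\<^sup>2 = integral {0..2*pi} (\<lambda>\<theta>. (norm (?w \<theta>))\<^sup>2)"
      by (simp add: boundary_error_def circle_L2_norm_def)
    define A1 A2 where "A1 = 4 * pi * V\<^sup>2" and "A2 = 4 * pi * D\<^sup>2 * V\<^sup>2 * R / R ^ (4 * M)"
    have A: "A1 \<ge> 0" "A2 \<ge> 0" using pos by (auto simp: A1_def A2_def)
    define maj where "maj l = A1 * (if \<bar>l\<bar> \<ge> int M then x ^ nat \<bar>l\<bar> else 0)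
        + A2 * (q (alias_freq M l) * (1 / R) ^ nat \<bar>alias_shift M l\<bar>)" for l
    have maj: "(maj has_sum A1 * (2 * x ^ M / (1 - x)) + A2 * ((\<Sum>m\<in>freq_window M. q m) * S)) UNIV"
      unfolding maj_def S_def
      by (intro has_sum_add has_sum_cmult_right has_sum_geometric_tail has_sum_over_aliases) (use x M R q0 in auto)
    have "2 * pi * (norm (e l))\<^sup>2 \<le> maj l" for l
    proof (cases "l \<in> freq_window M")
      case True
      have "alias_freq M l = l" using window_shift_unique(1)[OF True, of 0] by simp
      then have "e l = 0" using g0[of l] by (simp add: e_def \<beta>)
      then show ?thesis using A q0 x pos by (simp add: maj_def)
    next
      case False
      define l' n n' b where "l' = alias_freq M l" and "n = nat \<bar>l\<bar>" and "n' = nat \<bar>l'\<bar>" and "b = nat \<bar>alias_shift M l\<bar>"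
      note out = outside_window[OF M False]
      have nn': "n' \<le> n" using out unfolding n_def n'_def l'_def by linarith
      have b1: "b \<ge> 1" using out(1) by (simp add: b_def)
      have nb: "b * (2 * M) \<le> n + n'"
      proof -
        have "int (b * (2 * M)) \<le> int (n + n')"
          using out(4) by (simp add: b_def n_def n'_def l'_def)
        then show ?thesis by (simp only: of_nat_le_iff)
      qed
      \<comment> \<open>of the exponent \<open>4 M b\<close>, all but \<open>4 M + b - 1\<close> is given away; this leaves a geometric series in \<open>b\<close>\<close>
      have ex: "4 * M + b \<le> 2 * n + 2 * n' + 1"
      proof -
        obtain b' where b': "b = Suc b'" using b1 by (cases b) auto
        define p where "p = b' * (4 * M)"
        have "2 * (Suc b' * (2 * M)) = 4 * M + p" by (simp add: p_def algebra_simps)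
        moreover have "2 * (Suc b' * (2 * M)) \<le> 2 * (n + n')" using nb unfolding b' by (rule mult_le_mono2)
        ultimately have "4 * M + p \<le> 2 * (n + n')" by (simp only:)
        moreover have "b' \<le> p" using M by (simp add: p_def)
        ultimately have "4 * M + b' \<le> 2 * (n + n')" by (meson add_left_mono order_trans)
        then show ?thesis unfolding b' by simp
      qed
      define a where "a = norm (g l) * (1 / norm (g l')) * norm (fourier_coeff v l')"
      have a0: "a \<ge> 0" by (simp add: a_def)
      have "norm (e l) \<le> norm (\<i> / 4 * g l * \<beta> (alias_freq M l)) + norm (fourier_coeff v l)"
        unfolding e_def by (rule norm_triangle_ineq4)
      also have "norm (\<i> / 4 * g l * \<beta> (alias_freq M l)) = a"
        by (simp add: a_def \<beta> l'_def norm_mult norm_divide)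
      finally have e1: "norm (e l) \<le> a + V / \<rho> ^ n" using V(2)[of l] by (simp add: n_def)
      have "a \<le> (C / (R ^ n * (real n + 1))) * (R ^ n' * (real n' + 1) / c) * (V / \<rho> ^ n')"
        unfolding a_def using pos c C0 V
        by (intro mult_mono gup[of l, folded n_def] glow[of l', folded n'_def] V(2)[of l', folded n'_def]) auto
      also have "\<dots> = D * V * (R ^ n' / (R ^ n * \<rho> ^ n')) * ((real n' + 1) / (real n + 1))"
        by (simp add: D_def mult_ac)
      also have "\<dots> \<le> D * V * (R ^ n' / (R ^ n * \<rho> ^ n')) * 1"
        using nn' pos c C0 V by (intro mult_left_mono) (auto simp: D_def)
      finally have a1: "a \<le> D * V * (R ^ n' / (R ^ n * \<rho> ^ n'))" by simp
      have "a\<^sup>2 \<le> (D * V * (R ^ n' / (R ^ n * \<rho> ^ n')))\<^sup>2" by (rule power_mono[OF a1 a0])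
      also have "\<dots> = D\<^sup>2 * V\<^sup>2 / \<rho> ^ (2 * n') * (R ^ (2 * n') / R ^ (2 * n))"
        by (simp add: power_mult_distrib power_divide power_mult[symmetric] mult.commute)
      also have "\<dots> \<le> D\<^sup>2 * V\<^sup>2 / \<rho> ^ (2 * n') * (R ^ (4 * n') * R / (R ^ (4 * M) * R ^ b))"
      proof (intro mult_left_mono)
        have "R ^ (4 * M + b) \<le> R ^ (2 * n + 2 * n' + 1)" using R ex by (intro power_increasing) auto
        then have "R ^ (2 * n') * (R ^ (4 * M) * R ^ b) \<le> R ^ (2 * n') * (R ^ (2 * n) * R ^ (2 * n') * R)"
          using pos by (intro mult_left_mono) (auto simp: power_add mult_ac)
        also have "\<dots> = R ^ (4 * n') * R * R ^ (2 * n)"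
        proof -
          have "R ^ (4 * n') = R ^ (2 * n') * R ^ (2 * n')" by (simp add: power_add[symmetric])
          then show ?thesis by simp
        qed
        finally show "R ^ (2 * n') / R ^ (2 * n) \<le> R ^ (4 * n') * R / (R ^ (4 * M) * R ^ b)"
          using pos by (simp add: divide_simps mult.commute mult.left_commute)
      qed (use pos in auto)
      also have "\<dots> = D\<^sup>2 * V\<^sup>2 * R / R ^ (4 * M) * (q l' * (1 / R) ^ b)"
      proof -
        have "q l' = R ^ (4 * n') / \<rho> ^ (2 * n')"
          by (simp add: q_def n'_def[symmetric] power_divide power_mult[symmetric])
        then show ?thesis by (simp add: power_divide mult_ac)
      qed
      finally have a2: "a\<^sup>2 \<le> D\<^sup>2 * V\<^sup>2 * R / R ^ (4 * M) * (q l' * (1 / R) ^ b)" .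
      have "(norm (e l))\<^sup>2 \<le> (a + V / \<rho> ^ n)\<^sup>2" by (rule power_mono[OF e1]) simp
      also have "\<dots> \<le> 2 * a\<^sup>2 + 2 * (V / \<rho> ^ n)\<^sup>2"
        using zero_le_power2[of "a - V / \<rho> ^ n"] by (simp add: power2_sum power2_diff)
      also have "(V / \<rho> ^ n)\<^sup>2 = V\<^sup>2 * x ^ n" by (simp add: x_def power_divide power_mult[symmetric] mult.commute)
      finally have "2 * pi * (norm (e l))\<^sup>2 \<le> 2 * pi * (2 * a\<^sup>2 + 2 * (V\<^sup>2 * x ^ n))" by (intro mult_left_mono) auto
      also have "\<dots> \<le> 2 * pi * (2 * (D\<^sup>2 * V\<^sup>2 * R / R ^ (4 * M) * (q l' * (1 / R) ^ b)) + 2 * (V\<^sup>2 * x ^ n))"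
        using a2 by (intro mult_left_mono add_mono) auto
      also have "\<dots> = maj l"
        using out(2) by (simp add: maj_def A1_def A2_def n_def[symmetric] b_def[symmetric] l'_def[symmetric] algebra_simps)
      finally show ?thesis .
    qed
    then have "integral {0..2*pi} (\<lambda>\<theta>. (norm (?w \<theta>))\<^sup>2) \<le> A1 * (2 * x ^ M / (1 - x)) + A2 * ((\<Sum>m\<in>freq_window M. q m) * S)"
      by (intro has_sum_mono[OF P maj]) auto
    also have "x ^ M = 1 / \<rho> ^ (2 * M)" by (simp add: x_def power_divide power_mult)
    finally show ?thesis unfolding err by (simp add: A1_def A2_def K1_def K2_def mult_ac)
  qed
  have "(boundary_error k R v (2 * M) (mfs_coeff \<beta> (2 * M)))\<^sup>2
     \<le> (K1 + K2) * (1 / \<rho> ^ (2 * M) + 1 / R ^ (4 * M) * (\<Sum>m\<in>freq_window M. ((R\<^sup>2 / \<rho>)\<^sup>2) ^ nat \<bar>m\<bar>))" if M: "M > 0" for M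
  proof -
    have "0 \<le> K2 / \<rho> ^ (2 * M)" "0 \<le> K1 / R ^ (4 * M) * (\<Sum>m\<in>freq_window M. q m)"
      using K pos by (auto intro!: mult_nonneg_nonneg divide_nonneg_nonneg sum_nonneg q0)
    then show ?thesis using main[OF M] unfolding q_def by (simp add: algebra_simps add_divide_distrib)
  qed
  then show ?thesis using K by (intro exI[of _ "K1 + K2"]) auto
qed

text \<open>
  With \<open>y = (R\<^sup>2/\<rho>)\<^sup>2\<close> and \<open>N = 2 M\<close> one has \<open>y\<^sup>M / R\<^sup>4\<^sup>M = \<rho>\<^sup>-\<^sup>2\<^sup>M\<close>. For \<open>y > 1\<close> the geometric sum is
  comparable to \<open>y\<^sup>M\<close>, and both terms are of size \<open>\<rho>\<^sup>-\<^sup>N\<close>; for \<open>y = 1\<close> it has about \<open>N\<close> terms; for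
  \<open>y < 1\<close> it is bounded, and \<open>\<rho>\<^sup>-\<^sup>N \<le> R\<^sup>-\<^sup>2\<^sup>N\<close>.
\<close>

lemma convergence_rate:
  fixes E :: "nat \<Rightarrow> real"
  assumes R: "1 < R" "R < \<rho>" and K: "K \<ge> 0"
    and E: "\<And>M. M > 0 \<Longrightarrow> (E (2 * M))\<^sup>2 \<le> K * (1 / \<rho> ^ (2 * M) + 1 / R ^ (4 * M) * (\<Sum>m\<in>freq_window M. ((R\<^sup>2 / \<rho>)\<^sup>2) ^ nat \<bar>m\<bar>))"
  shows "\<exists>C. \<forall>N. N > 0 \<and> even N \<longrightarrow> E N \<le>
                (if \<rho> < R\<^sup>2 then C * \<rho> powr (- (real N / 2))
                 else if \<rho> = R\<^sup>2 then C * sqrt (real N) * R powr (- real N)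
                 else C * R powr (- real N))"
proof -
  have pos: "R > 0" "\<rho> > 0" using R by auto
  define y where "y = (R\<^sup>2 / \<rho>)\<^sup>2"
  have y0: "y > 0" using pos by (simp add: y_def)
  define Q where "Q M = (\<Sum>m\<in>freq_window M. y ^ nat \<bar>m\<bar>)" for M
  have Q: "Q M \<le> 2 * (\<Sum>n\<le>M. y ^ n)" for M
    unfolding Q_def using y0 by (intro sum_window_le) auto
  have E': "(E (2 * M))\<^sup>2 \<le> K * (1 / \<rho> ^ (2 * M) + 1 / R ^ (4 * M) * Q M)" if "M > 0" for M
    using E[OF that] unfolding Q_def y_def .
  have yM: "y ^ M / R ^ (4 * M) = 1 / \<rho> ^ (2 * M)" for M
  proof -
    have "y ^ M = R ^ (4 * M) / \<rho> ^ (2 * M)" by (simp add: y_def power_divide power_mult[symmetric])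
    then show ?thesis using pos by simp
  qed
  have pow1: "\<rho> powr (- (real (2 * M) / 2)) = 1 / \<rho> ^ M" for M
    using powr_realpow[OF pos(2), of M] by (simp add: powr_minus_divide)
  have pow2: "R powr (- real (2 * M)) = 1 / R ^ (2 * M)" for M
    using powr_realpow[OF pos(1), of "2 * M"] by (simp only: powr_minus_divide)
  have evens: "\<forall>N. N > 0 \<and> even N \<longrightarrow> P N" if "\<And>M. M > 0 \<Longrightarrow> P (2 * M)" for P :: "nat \<Rightarrow> bool"
  proof (intro allI impI)
    fix N :: nat assume N: "N > 0 \<and> even N"
    then obtain M where "N = 2 * M" by (blast elim: evenE)
    then show "P N" using N that[of M] by simp
  qed
  consider "\<rho> < R\<^sup>2" | "\<rho> = R\<^sup>2" | "\<rho> > R\<^sup>2" by linarith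
  then show ?thesis
  proof cases
    case 1
    have y1: "y > 1" using 1 pos by (simp add: y_def)
    define L where "L = K * (1 + 2 * y / (y - 1))"
    have L: "L \<ge> 0" using K y1 by (simp add: L_def)
    have "E (2 * M) \<le> sqrt L * \<rho> powr (- (real (2 * M) / 2))" if M: "M > 0" for M
    proof -
      have "(\<Sum>n\<le>M. y ^ n) = (y * y ^ M - 1) / (y - 1)"
        using y1 sum_gp0[of y M] by (simp add: field_simps)
      also have "\<dots> \<le> y * y ^ M / (y - 1)" using y1 by (intro divide_right_mono) auto
      finally have "Q M \<le> 2 * (y * y ^ M / (y - 1))" using Q[of M] by linarith
      then have "1 / R ^ (4 * M) * Q M \<le> 1 / R ^ (4 * M) * (2 * (y * y ^ M / (y - 1)))"
        using pos by (intro mult_left_mono) auto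
      also have "\<dots> = 2 * y / (y - 1) * (y ^ M / R ^ (4 * M))" by (simp add: mult_ac)
      finally have "1 / R ^ (4 * M) * Q M \<le> 2 * y / (y - 1) * (1 / \<rho> ^ (2 * M))" unfolding yM .
      then have "K * (1 / \<rho> ^ (2 * M) + 1 / R ^ (4 * M) * Q M) \<le> K * (1 / \<rho> ^ (2 * M) + 2 * y / (y - 1) * (1 / \<rho> ^ (2 * M)))"
        by (rule mult_left_mono[OF add_left_mono]) (rule K)
      also have "\<dots> = L * (1 / \<rho> ^ M)\<^sup>2" by (simp add: L_def algebra_simps power_divide power_mult[symmetric])
      finally have "(E (2 * M))\<^sup>2 \<le> (sqrt L * (1 / \<rho> ^ M))\<^sup>2"
        using E'[OF M] unfolding power_mult_distrib[of "sqrt L"] real_sqrt_pow2[OF L] by linarith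
      then show ?thesis unfolding pow1 by (rule power2_le_imp_le) (use pos L in auto)
    qed
    then have "\<forall>N. N > 0 \<and> even N \<longrightarrow> E N \<le> sqrt L * \<rho> powr (- (real N / 2))" by (rule evens)
    then show ?thesis unfolding if_P[OF 1] by blast
  next
    case 2
    have y1: "y = 1" using 2 pos by (simp add: y_def)
    have "E (2 * M) \<le> sqrt (5 * K) * sqrt (real (2 * M)) * R powr (- real (2 * M))" if M: "M > 0" for M
    proof -
      have "Q M \<le> 2 * (real M + 1)" using Q[of M] by (simp add: y1)
      then have "1 / R ^ (4 * M) * Q M \<le> 1 / R ^ (4 * M) * (2 * (real M + 1))" using pos by (intro mult_left_mono) auto
      then have "K * (1 / \<rho> ^ (2 * M) + 1 / R ^ (4 * M) * Q M) \<le> K * (1 / \<rho> ^ (2 * M) + 1 / R ^ (4 * M) * (2 * (real M + 1)))"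
        by (rule mult_left_mono[OF add_left_mono]) (rule K)
      also have e: "1 / \<rho> ^ (2 * M) = 1 / R ^ (4 * M)" using yM[of M] y1 by simp
      also have "K * (1 / R ^ (4 * M) + 1 / R ^ (4 * M) * (2 * (real M + 1))) = K * (2 * real M + 3) * (1 / R ^ (2 * M))\<^sup>2"
        by (simp add: algebra_simps power_divide power_mult[symmetric] add_divide_distrib)
      also have "\<dots> \<le> K * (5 * real (2 * M)) * (1 / R ^ (2 * M))\<^sup>2"
        using M K by (intro mult_right_mono mult_left_mono) auto
      also have "\<dots> = (sqrt (5 * K) * sqrt (real (2 * M)) * (1 / R ^ (2 * M)))\<^sup>2"
      proof -
        have "5 * K \<ge> 0" "real (2 * M) \<ge> 0" using K by auto
        then show ?thesis by (simp only: power_mult_distrib real_sqrt_pow2 mult_ac)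
      qed
      finally have "(E (2 * M))\<^sup>2 \<le> (sqrt (5 * K) * sqrt (real (2 * M)) * (1 / R ^ (2 * M)))\<^sup>2"
        using E'[OF M] unfolding e by linarith
      then show ?thesis unfolding pow2 by (rule power2_le_imp_le) (use pos K in auto)
    qed
    then have "\<forall>N. N > 0 \<and> even N \<longrightarrow> E N \<le> sqrt (5 * K) * sqrt (real N) * R powr (- real N)" by (rule evens)
    then show ?thesis using 2 by auto
  next
    case 3
    have y1: "y < 1" using 3 pos by (simp add: y_def power_less_one_iff)
    define L where "L = K * (1 + 2 / (1 - y))"
    have L: "L \<ge> 0" using K y1 by (simp add: L_def)
    have "E (2 * M) \<le> sqrt L * R powr (- real (2 * M))" if M: "M > 0" for M
    proof -
      have "(\<Sum>n\<le>M. y ^ n) = (1 - y * y ^ M) / (1 - y)"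
        using y1 sum_gp0[of y M] by simp
      also have "\<dots> \<le> 1 / (1 - y)" using y1 y0 by (intro divide_right_mono) auto
      finally have "Q M \<le> 2 * (1 / (1 - y))" using Q[of M] by linarith
      then have b: "1 / R ^ (4 * M) * Q M \<le> 1 / R ^ (4 * M) * (2 * (1 / (1 - y)))"
        using pos by (intro mult_left_mono) auto
      have a: "1 / \<rho> ^ (2 * M) \<le> 1 / R ^ (4 * M)"
      proof -
        have "(R\<^sup>2) ^ (2 * M) \<le> \<rho> ^ (2 * M)" using 3 by (intro power_mono) auto
        then show ?thesis using pos by (simp add: power_mult[symmetric] frac_le)
      qed
      have "K * (1 / \<rho> ^ (2 * M) + 1 / R ^ (4 * M) * Q M) \<le> K * (1 / R ^ (4 * M) + 1 / R ^ (4 * M) * (2 * (1 / (1 - y))))"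
        by (rule mult_left_mono[OF add_mono[OF a b] K])
      also have "\<dots> = L * (1 / R ^ (2 * M))\<^sup>2"
        by (simp add: L_def algebra_simps power_divide power_mult[symmetric])
      finally have "(E (2 * M))\<^sup>2 \<le> (sqrt L * (1 / R ^ (2 * M)))\<^sup>2"
        using E'[OF M] unfolding power_mult_distrib[of "sqrt L"] real_sqrt_pow2[OF L] by linarith
      then show ?thesis unfolding pow2 by (rule power2_le_imp_le) (use pos L in auto)
    qed
    then have "\<forall>N. N > 0 \<and> even N \<longrightarrow> E N \<le> sqrt L * R powr (- real N)" by (rule evens)
    then show ?thesis using 3 by auto
  qed
qed

theorem theorem6:
  fixes k R \<rho> C0 :: real and v :: "complex \<Rightarrow> complex"
  assumes "k > 0"
    and not_dirichlet_eigenvalue: "\<And>m::int. bessel_J m k \<noteq> 0"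
    and "1 < R" and "R < \<rho>"
    and "analytic_on_circle v"
    and "C0 > 0"
    and "(\<lambda>m. cmod (fourier_coeff v m))
           \<sim>[filtercomap (abs :: int \<Rightarrow> int) at_top] (\<lambda>m. C0 * \<rho> powi (- \<bar>m\<bar>))"
  shows "\<exists>\<alpha> :: nat \<Rightarrow> nat \<Rightarrow> complex.
           (\<exists>B. \<forall>N. N > 0 \<and> even N \<longrightarrow> coeff_norm N (\<alpha> N) \<le> B) \<and>
           (\<exists>C. \<forall>N. N > 0 \<and> even N \<longrightarrow>
              boundary_error k R v N (\<alpha> N) \<le>
                (if \<rho> < R\<^sup>2 then C * \<rho> powr (- (real N / 2))
                 else if \<rho> = R\<^sup>2 then C * sqrt (real N) * R powr (- real N)
                 else C * R powr (- real N)))"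
proof -
  note k = assms(1) and R = assms(3,4)
  have pos: "R > 0" "\<rho> > 0" using R by auto
  obtain f where f: "f analytic_on sphere 0 1" "\<forall>z\<in>sphere 0 1. v z = f z"
    using assms(5) by (auto simp: analytic_on_circle_def)
  have v: "continuous_on (sphere 0 1) v"
    by (rule continuous_on_eq[OF holomorphic_on_imp_continuous_on[OF analytic_imp_holomorphic[OF f(1)]]])
       (use f(2) in simp)
  obtain V where V: "V \<ge> 0" "\<And>m. cmod (fourier_coeff v m) \<le> V / \<rho> ^ nat \<bar>m\<bar>"
    using fourier_coeff_decay[OF pos(2) assms(7)] by blast
  obtain g c C where c: "c > 0" "\<And>l. c \<le> norm (g l) * R ^ nat \<bar>l\<bar> * (real (nat \<bar>l\<bar>) + 1)"
    and C: "\<And>l. norm (g l) * R ^ nat \<bar>l\<bar> * (real (nat \<bar>l\<bar>) + 1) \<le> C"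
    and g: "\<And>z. norm z = 1 \<Longrightarrow> ((\<lambda>l. g l * z powi l) has_sum hankel_sq k ((of_real R - z) * (of_real R - cnj z))) UNIV"
    using hankel_kernel_fourier_expansion[OF k R(1) not_dirichlet_eigenvalue] by blast
  \<comment> \<open>this choice reproduces all Fourier coefficients of \<open>v\<close> in the window exactly\<close>
  define \<beta> where "\<beta> m = fourier_coeff v m / (\<i> / 4 * g m)" for m
  obtain K where K: "K \<ge> 0" "\<And>M. M > 0 \<Longrightarrow> (boundary_error k R v (2 * M) (mfs_coeff \<beta> (2 * M)))\<^sup>2
     \<le> K * (1 / \<rho> ^ (2 * M) + 1 / R ^ (4 * M) * (\<Sum>m\<in>freq_window M. ((R\<^sup>2 / \<rho>)\<^sup>2) ^ nat \<bar>m\<bar>))"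
    using boundary_error_sq_bound[OF k R v c C g V \<beta>_def] by blast
  define t where "t = R / \<rho>"
  have t: "0 < t" "t < 1" using R pos by (auto simp: t_def)
  have \<beta>: "cmod (\<beta> m) \<le> 4 * V / c * (real (Suc (nat \<bar>m\<bar>)) * t ^ nat \<bar>m\<bar>)" for m
  proof -
    have "g m \<noteq> 0" using c(1) c(2)[of m] by auto
    then have "1 / norm (g m) \<le> R ^ nat \<bar>m\<bar> * (real (nat \<bar>m\<bar>) + 1) / c"
      using c(1) c(2)[of m] by (simp add: field_simps del: of_nat_nat)
    then have "4 * (norm (fourier_coeff v m) * (1 / norm (g m))) \<le> 4 * ((V / \<rho> ^ nat \<bar>m\<bar>) * (R ^ nat \<bar>m\<bar> * (real (nat \<bar>m\<bar>) + 1) / c))"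
      using V pos by (intro mult_left_mono mult_mono) auto
    moreover have "4 * ((V / P) * (Q * y / c)) = 4 * V / c * (y * (Q / P))" for P Q y :: real
      by (simp add: mult_ac)
    moreover have "real (Suc (nat \<bar>m\<bar>)) = real (nat \<bar>m\<bar>) + 1" by simp
    moreover have "cmod (\<beta> m) = 4 * (norm (fourier_coeff v m) * (1 / norm (g m)))"
      by (simp add: \<beta>_def norm_divide norm_mult)
    ultimately show ?thesis by (simp only: t_def power_divide)
  qed
  \<comment> \<open>the window sum is bounded by twice the full series \<open>\<Sum>n. (n+1) t\<^sup>n = 1/(1-t)\<^sup>2\<close>\<close>
  have "coeff_norm N (mfs_coeff \<beta> N) \<le> 2 * (4 * V / c * (1 / (1 - t)\<^sup>2))" if N: "N > 0" for N
  proof -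
    let ?f = "\<lambda>n. 4 * V / c * (real (Suc n) * t ^ n)"
    have f0: "?f n \<ge> 0" for n using V c t by simp
    have s: "?f sums (4 * V / c * (1 / (1 - t)\<^sup>2))"
      using t by (intro sums_mult geometric_deriv_sums) auto
    have "coeff_norm N (mfs_coeff \<beta> N) \<le> (\<Sum>m\<in>freq_window (N div 2). ?f (nat \<bar>m\<bar>))"
      by (rule order_trans[OF coeff_norm_mfs_coeff[OF N] sum_mono[OF \<beta>]])
    also have "\<dots> \<le> 2 * (\<Sum>n\<le>N div 2. ?f n)" by (rule sum_window_le[OF f0])
    also have "\<dots> \<le> 2 * (4 * V / c * (1 / (1 - t)\<^sup>2))"
      using sum_le_suminf[OF sums_summable[OF s], of "{..N div 2}"] f0 unfolding sums_unique[OF s, symmetric] by simp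
    finally show ?thesis .
  qed
  moreover note convergence_rate[OF R K(1), of "\<lambda>N. boundary_error k R v N (mfs_coeff \<beta> N)", OF K(2)]
  ultimately show ?thesis by (intro exI[of _ "mfs_coeff \<beta>"]) blast
qed

end
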